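(* Let $n>k$ be positive integers. Then \[\frac{n}{k}\ \le\ \rho(C_{2k+1},C_{2n+1})\ \le\ \left\lceil\frac{n}{k}\right\rceil+1.\]
   Context: $C_\ell$ denotes the cycle with $\ell$ edges. A graphon is a symmetric measurable function $W:[0,1]^2\to[0,1]$. For a finite simple graph $G$ with vertices $v_1,\dots,v_n$, put $t(G,W)=\int_{[0,1]^n}\prod_{v_iv_j\in E(G)}W(x_i,x_j)\,dx_1\cdots dx_n$; for a finite graph $W$ (loops allowed), $t(G,W)=\hom(G,W)/|V(W)|^{|V(G)|}$, where $\hom(G,W)$ is the number of maps $V(G)\to V(W)$ sending edges to edges. For finite simple graphs $G,H$, the density domination exponent is $\rho(G,H)=\sup_W \frac{\log t(H,W)}{\log t(G,W)}\in[0,\infty]$, where $W$ ranges over all graphons (equivalently, all finite graphs) with $t(G,W)\ne 0$. Conventions: those $W$ with $t(G,W)=1$, where the quotient is undefined, are omitted; $\log 0=-\infty$, so the quotient is $+\infty$ if $t(H,W)=0$. Thus, when $G$ has at least one edge, for $c>0$ one has $\rho(G,H)\le c$ if and only if $t(H,W)\ge t(G,W)^c$ for every $W$. *)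

theory Defs
  imports "HOL-Analysis.Analysis"
begin

record 'a ugraph =
  verts :: "'a set"
  edges :: "'a set set"

definition finite_simple_graph :: "'a ugraph \<Rightarrow> bool" where
  "finite_simple_graph G \<longleftrightarrow>
     finite (verts G) \<and> edges G \<subseteq> {{u, v} |u v. u \<in> verts G \<and> v \<in> verts G \<and> u \<noteq> v}"

text \<open>A cycle in the usual sense only for \<open>l \<ge> 3\<close>.\<close>

definition cycle_graph :: "nat \<Rightarrow> nat ugraph" where
  "cycle_graph l = \<lparr>verts = {..<l}, edges = {{i, (i + 1) mod l} |i. i < l}\<rparr>"

lemma finite_simple_graph_cycle_graph:
  assumes "l \<ge> 3"
  shows "finite_simple_graph (cycle_graph l)"
proof -
  have "i \<noteq> Suc i mod l" if "i < l" for i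
    using that assms by (cases "Suc i = l") auto
  moreover have "Suc i mod l < l" for i
    using assms by simp
  ultimately show ?thesis
    unfolding finite_simple_graph_def cycle_graph_def by fastforce
qed

abbreviation unit_interval_measure :: "real measure" where
  "unit_interval_measure \<equiv> restrict_space lborel {0..1}"

text \<open>Only the values on \<open>{0..1} \<times> {0..1}\<close> are relevant; measurability is with respect to
  the Borel sets of the unit square.\<close>

definition graphon :: "(real \<times> real \<Rightarrow> real) \<Rightarrow> bool" where
  "graphon W \<longleftrightarrow>
     W \<in> borel_measurable (unit_interval_measure \<Otimes>\<^sub>M unit_interval_measure) \<and>
     (\<forall>x\<in>{0..1}. \<forall>y\<in>{0..1}. W (x, y) = W (y, x) \<and> W (x, y) \<in> {0..1})"

text \<open>The order on the vertices is used only to list every edge exactly once, as \<open>(i, j)\<close>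
  with \<open>i < j\<close>; since a graphon is symmetric, the choice of order is immaterial.\<close>

definition hom_density :: "'a::linorder ugraph \<Rightarrow> (real \<times> real \<Rightarrow> real) \<Rightarrow> real" where
  "hom_density G W =
     (LINT x | Pi\<^sub>M (verts G) (\<lambda>_. unit_interval_measure).
        (\<Prod>(i, j) \<in> {(i, j). i < j \<and> {i, j} \<in> edges G}. W (x i, x j)))"

definition ext_ln :: "real \<Rightarrow> ereal" where
  "ext_ln x = (if x = 0 then - \<infinity> else ereal (ln x))"

text \<open>For a graphon \<open>W\<close> and finite simple graphs \<open>G\<close>, \<open>H\<close> both densities lie in \<open>{0..1}\<close>, so
  every quotient below is nonnegative and \<^const>\<open>e2ennreal\<close> only changes its type; in particular
  the quotient is \<open>(- \<infinity>) / ln (hom_density G W) = \<infinity>\<close> when \<open>hom_density H W = 0\<close>.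
  The supremum is taken in \<open>[0, \<infinity>]\<close>.\<close>

definition density_domination_exponent ::
    "'a::linorder ugraph \<Rightarrow> 'b::linorder ugraph \<Rightarrow> ennreal" where
  "density_domination_exponent G H =
     (SUP W \<in> {W. graphon W \<and> hom_density G W \<noteq> 0 \<and> hom_density G W \<noteq> 1}.
        e2ennreal (ext_ln (hom_density H W) / ext_ln (hom_density G W)))"

end

theory Submission
  imports Defs "HOL-Probability.Probability"
begin

text \<open>For the lower bound, the disjoint union of two cliques of measure \<open>1/2\<close> has
  \<open>t(C\<^sub>l) = 2 powr (1 - l)\<close>, which gives the quotient \<open>2n / 2k\<close>.

  For the upper bound, perturb the graphon so that it is bounded away from \<open>0\<close>, and let
  \<open>\<tau> = t(C\<^bsub>2k+1\<^esub>)\<close>, \<open>t = t(C\<^bsub>2n+1\<^esub>)\<close>, \<open>N = 2(n - k)\<close>. Let \<open>m \<le> 0\<close> be the expectation, over a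
  random \<open>C\<^bsub>2k+1\<^esub>\<close>, of the logarithm of the number of \<open>2k\<close>-walks between the ends of an edge. Two
  entropy arguments, each an application of Jensen's inequality to \<open>ln\<close>, give
  \<^item> \<open>(2k - 1) ln (t / \<tau>) \<ge> N m\<close>: fix a vertex of \<open>C\<^bsub>2k+1\<^esub>\<close> and traverse one of the \<open>2k - 1\<close> edges away
    from it \<open>N\<close> more times, with the new vertices resampled;
  \<^item> \<open>ln (t / \<tau>) \<ge> (N + 1) (ln \<tau> - m)\<close>: glue a cycle of length \<open>N + 2\<close> to \<open>C\<^bsub>2k+1\<^esub>\<close> along an edge.

  Eliminating \<open>m\<close> yields \<open>t \<ge> \<tau> powr (n / k + 1)\<close>.\<close>

section \<open>Bounded and positive measurable functions\<close>

definition bdd_meas :: "'a measure \<Rightarrow> ('a \<Rightarrow> real) \<Rightarrow> bool" where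
  "bdd_meas N f \<longleftrightarrow> f \<in> borel_measurable N \<and> (\<exists>C. \<forall>x\<in>space N. \<bar>f x\<bar> \<le> C)"

text \<open>The bounds are uniform and hold at every point, so that logarithms and quotients stay
  bounded and every integral below exists without an almost-everywhere argument.\<close>

definition pos_meas :: "'a measure \<Rightarrow> ('a \<Rightarrow> real) \<Rightarrow> bool" where
  "pos_meas N f \<longleftrightarrow>
     f \<in> borel_measurable N \<and> (\<exists>c>0. \<exists>C. \<forall>x\<in>space N. c \<le> f x \<and> f x \<le> C)"

lemma bdd_meas_measurable: "bdd_meas N f \<Longrightarrow> f \<in> borel_measurable N"
  by (simp add: bdd_meas_def)

lemma pos_meas_pos: "pos_meas N f \<Longrightarrow> x \<in> space N \<Longrightarrow> 0 < f x"
  unfolding pos_meas_def by force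

lemma pos_meas_imp_bdd_meas: "pos_meas N f \<Longrightarrow> bdd_meas N f"
  unfolding pos_meas_def bdd_meas_def by (metis abs_of_pos less_le_trans)

lemma bdd_meas_const: "bdd_meas N (\<lambda>_. c)"
  unfolding bdd_meas_def by auto

lemma bdd_meas_add:
  assumes "bdd_meas N f" "bdd_meas N g"
  shows "bdd_meas N (\<lambda>x. f x + g x)"
proof -
  obtain C D where "\<forall>x\<in>space N. \<bar>f x\<bar> \<le> C" "\<forall>x\<in>space N. \<bar>g x\<bar> \<le> D"
    using assms unfolding bdd_meas_def by blast
  then have "\<forall>x\<in>space N. \<bar>f x + g x\<bar> \<le> C + D"
    by (meson abs_triangle_ineq add_mono order_trans)
  then show ?thesis
    using assms unfolding bdd_meas_def by (auto intro: borel_measurable_add)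
qed

lemma bdd_meas_mult:
  assumes "bdd_meas N f" "bdd_meas N g"
  shows "bdd_meas N (\<lambda>x. f x * g x)"
proof -
  obtain C D where CD: "\<forall>x\<in>space N. \<bar>f x\<bar> \<le> C" "\<forall>x\<in>space N. \<bar>g x\<bar> \<le> D"
    using assms unfolding bdd_meas_def by blast
  have "\<bar>f x * g x\<bar> \<le> C * D" if "x \<in> space N" for x
    unfolding abs_mult using CD that by (meson abs_ge_zero mult_mono order_trans)
  then show ?thesis
    using assms unfolding bdd_meas_def by (auto intro: borel_measurable_times)
qed

lemma bdd_meas_diff:
  assumes "bdd_meas N f" "bdd_meas N g"
  shows "bdd_meas N (\<lambda>x. f x - g x)"
  using bdd_meas_add[OF assms(1) bdd_meas_mult[OF bdd_meas_const[of N "-1"] assms(2)]] by simp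

lemma pos_meas_mult:
  assumes "pos_meas N f" "pos_meas N g"
  shows "pos_meas N (\<lambda>x. f x * g x)"
proof -
  obtain c C d D where CD: "c > 0" "d > 0" "\<forall>x\<in>space N. c \<le> f x \<and> f x \<le> C"
    "\<forall>x\<in>space N. d \<le> g x \<and> g x \<le> D"
    using assms unfolding pos_meas_def by blast
  have "c * d \<le> f x * g x \<and> f x * g x \<le> C * D" if "x \<in> space N" for x
  proof -
    have "c \<le> f x" "f x \<le> C" "d \<le> g x" "g x \<le> D" using CD that by auto
    with CD(1,2) show ?thesis by (intro conjI mult_mono) auto
  qed
  moreover have "c * d > 0" using CD by simp
  ultimately show ?thesis
    using assms unfolding pos_meas_def by (auto intro: borel_measurable_times)
qed

lemma pos_meas_inverse:
  assumes "pos_meas N f"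
  shows "pos_meas N (\<lambda>x. inverse (f x))"
proof -
  obtain c C where CD: "c > 0" "\<forall>x\<in>space N. c \<le> f x \<and> f x \<le> C"
    using assms unfolding pos_meas_def by blast
  have "inverse (max c C) \<le> inverse (f x) \<and> inverse (f x) \<le> inverse c" if "x \<in> space N" for x
  proof -
    have "c \<le> f x" "f x \<le> max c C" using CD that by auto
    with CD(1) show ?thesis by (intro conjI le_imp_inverse_le) auto
  qed
  moreover have "inverse (max c C) > 0" using CD by auto
  moreover have "(\<lambda>x. inverse (f x)) \<in> borel_measurable N"
    using assms unfolding pos_meas_def by (auto intro: borel_measurable_inverse)
  ultimately show ?thesis
    unfolding pos_meas_def by blast
qed

lemma pos_meas_divide:
  assumes "pos_meas N f" "pos_meas N g"
  shows "pos_meas N (\<lambda>x. f x / g x)"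
  using pos_meas_mult[OF assms(1) pos_meas_inverse[OF assms(2)]] by (simp add: divide_inverse)

lemma bdd_meas_ln:
  assumes "pos_meas N f"
  shows "bdd_meas N (\<lambda>x. ln (f x))"
proof -
  obtain c C where CD: "c > 0" "\<forall>x\<in>space N. c \<le> f x \<and> f x \<le> C"
    using assms unfolding pos_meas_def by blast
  have "\<bar>ln (f x)\<bar> \<le> \<bar>ln c\<bar> + \<bar>ln C\<bar>" if "x \<in> space N" for x
  proof -
    have "c \<le> f x" "f x \<le> C" using CD that by auto
    then have "ln c \<le> ln (f x)" "ln (f x) \<le> ln C" using CD(1) by auto
    then show ?thesis by linarith
  qed
  then show ?thesis
    using assms unfolding bdd_meas_def pos_meas_def by (auto intro: borel_measurable_ln)
qed

lemma pos_meas_compose: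
  "pos_meas N f \<Longrightarrow> g \<in> measurable L N \<Longrightarrow> pos_meas L (\<lambda>x. f (g x))"
  unfolding pos_meas_def by (auto dest: measurable_space intro: measurable_compose) (meson measurable_space)

lemma bdd_meas_divide:
  assumes "bdd_meas N f" "pos_meas N g"
  shows "bdd_meas N (\<lambda>x. f x / g x)"
  using bdd_meas_mult[OF assms(1) pos_meas_imp_bdd_meas[OF pos_meas_inverse[OF assms(2)]]]
  by (simp add: divide_inverse)

lemma pos_meas_compose2:
  assumes "pos_meas (N \<Otimes>\<^sub>M N') (\<lambda>p. F (fst p) (snd p))" "f \<in> measurable L N" "g \<in> measurable L N'"
  shows "pos_meas L (\<lambda>w. F (f w) (g w))"
  using pos_meas_compose[OF assms(1) measurable_Pair[OF assms(2,3)]] by simp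

lemma bdd_meas_compose:
  "bdd_meas N f \<Longrightarrow> g \<in> measurable L N \<Longrightarrow> bdd_meas L (\<lambda>x. f (g x))"
  unfolding bdd_meas_def by (auto dest: measurable_space intro: measurable_compose)

lemma bdd_meas_compose2:
  assumes "bdd_meas (N \<Otimes>\<^sub>M N') (\<lambda>p. F (fst p) (snd p))" "f \<in> measurable L N" "g \<in> measurable L N'"
  shows "bdd_meas L (\<lambda>w. F (f w) (g w))"
  using bdd_meas_compose[OF assms(1) measurable_Pair[OF assms(2,3)]] by simp

lemma bdd_meas_prod:
  assumes "finite I" "\<And>i. i \<in> I \<Longrightarrow> bdd_meas N (f i)"
  shows "bdd_meas N (\<lambda>x. \<Prod>i\<in>I. f i x)"
  using assms by (induction I) (auto intro: bdd_meas_const bdd_meas_mult)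

lemmas bdd_pos_meas_intros =
  bdd_meas_const bdd_meas_add bdd_meas_diff bdd_meas_mult bdd_meas_divide bdd_meas_ln
  pos_meas_mult pos_meas_divide

section \<open>Integrals over a probability space and Jensen's inequality for the logarithm\<close>

context prob_space
begin

lemma bdd_meas_integrable: "bdd_meas M f \<Longrightarrow> integrable M f"
  unfolding bdd_meas_def by (metis AE_I2 integrable_const_bound real_norm_def)

text \<open>Keeps parametric integrals inside the class of bounded measurable functions, so that
  iterated integrals can be formed and their order exchanged.\<close>

lemma bdd_meas_integral:
  assumes "bdd_meas (N \<Otimes>\<^sub>M M) (\<lambda>p. F (fst p) (snd p))"
  shows "bdd_meas N (\<lambda>x. \<integral>y. F x y \<partial>M)"
proof -
  obtain C where C: "\<forall>p\<in>space (N \<Otimes>\<^sub>M M). \<bar>F (fst p) (snd p)\<bar> \<le> C"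
    and m: "(\<lambda>p. F (fst p) (snd p)) \<in> borel_measurable (N \<Otimes>\<^sub>M M)"
    using assms unfolding bdd_meas_def by blast
  have "\<bar>\<integral>y. F x y \<partial>M\<bar> \<le> C" if x: "x \<in> space N" for x
  proof -
    have mx: "F x \<in> borel_measurable M"
      using measurable_compose[OF measurable_Pair1'[OF x] m] by simp
    have b: "\<bar>F x y\<bar> \<le> C" if "y \<in> space M" for y
      using C x that by (auto simp: space_pair_measure)
    then have "bdd_meas M (F x)" using mx unfolding bdd_meas_def by blast
    then have i: "integrable M (F x)" by (rule bdd_meas_integrable)
    have "\<bar>\<integral>y. F x y \<partial>M\<bar> \<le> (\<integral>y. \<bar>F x y\<bar> \<partial>M)" by (rule integral_abs_bound)
    also have "\<dots> \<le> (\<integral>y. C \<partial>M)" using i b by (intro integral_mono) auto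
    finally show ?thesis by (simp add: prob_space)
  qed
  moreover have "(\<lambda>x. \<integral>y. F x y \<partial>M) \<in> borel_measurable N"
    using m by (intro borel_measurable_lebesgue_integral) (simp add: case_prod_beta')
  ultimately show ?thesis unfolding bdd_meas_def by blast
qed

lemma pos_meas_integral:
  assumes "pos_meas (N \<Otimes>\<^sub>M M) (\<lambda>p. F (fst p) (snd p))"
  shows "pos_meas N (\<lambda>x. \<integral>y. F x y \<partial>M)"
proof -
  obtain c C where C: "c > 0" "\<forall>p\<in>space (N \<Otimes>\<^sub>M M). c \<le> F (fst p) (snd p) \<and> F (fst p) (snd p) \<le> C"
    and m: "(\<lambda>p. F (fst p) (snd p)) \<in> borel_measurable (N \<Otimes>\<^sub>M M)"
    using assms unfolding pos_meas_def by blast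
  have "c \<le> (\<integral>y. F x y \<partial>M) \<and> (\<integral>y. F x y \<partial>M) \<le> C" if x: "x \<in> space N" for x
  proof -
    have mx: "F x \<in> borel_measurable M"
      using measurable_compose[OF measurable_Pair1'[OF x] m] by simp
    have b: "c \<le> F x y \<and> F x y \<le> C" if "y \<in> space M" for y
      using C x that by (auto simp: space_pair_measure)
    then have "pos_meas M (F x)" using mx C(1) unfolding pos_meas_def by blast
    then have i: "integrable M (F x)" by (intro bdd_meas_integrable pos_meas_imp_bdd_meas)
    have "(\<integral>y. c \<partial>M) \<le> (\<integral>y. F x y \<partial>M)" "(\<integral>y. F x y \<partial>M) \<le> (\<integral>y. C \<partial>M)"
      using i b by (intro integral_mono; simp)+
    then show ?thesis by (simp add: prob_space)
  qed
  moreover have "(\<lambda>x. \<integral>y. F x y \<partial>M) \<in> borel_measurable N"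
    using m by (intro borel_measurable_lebesgue_integral) (simp add: case_prod_beta')
  ultimately show ?thesis using C(1) unfolding pos_meas_def by blast
qed

lemma pos_meas_integral_pos:
  assumes f: "pos_meas M f"
  shows "0 < (\<integral>x. f x \<partial>M)"
proof -
  obtain c where c: "c > 0" "\<forall>x\<in>space M. c \<le> f x"
    using f unfolding pos_meas_def by blast
  have "(\<integral>y. c \<partial>M) \<le> (\<integral>y. f y \<partial>M)"
    using c bdd_meas_integrable[OF pos_meas_imp_bdd_meas[OF f]] by (intro integral_mono) auto
  with c show ?thesis by (simp add: prob_space)
qed

lemma bdd_meas_swap:
  assumes "bdd_meas (M \<Otimes>\<^sub>M M) (\<lambda>p. F (fst p) (snd p))"
  shows "(\<integral>x. \<integral>y. F x y \<partial>M \<partial>M) = (\<integral>y. \<integral>x. F x y \<partial>M \<partial>M)"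
proof -
  interpret P: pair_prob_space M M ..
  show ?thesis
    using P.bdd_meas_integrable[OF assms]
    by (intro P.Fubini_integral[symmetric]) (simp add: case_prod_beta')
qed

text \<open>Jensen's inequality for the concave function \<open>ln\<close> under an unnormalised
  weight. It comes from integrating the tangent bound \<open>ln u \<le> u - 1\<close> at
  \<open>u = f x * T / S\<close>, where \<open>S / T\<close> is the weighted mean of
  \<open>f\<close>. Carrying the total mass along avoids normalising the walk densities
  later.\<close>

lemma ln_integral_ge:
  assumes w: "pos_meas M w" and f: "pos_meas M f"
  shows "(\<integral>x. w x * ln (f x) \<partial>M)
           \<le> (\<integral>x. w x \<partial>M) * ln ((\<integral>x. w x * f x \<partial>M) / (\<integral>x. w x \<partial>M))"
proof -
  define T S where "T = (\<integral>x. w x \<partial>M)" and "S = (\<integral>x. w x * f x \<partial>M)"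
  have T: "T > 0" and S: "S > 0"
    unfolding T_def S_def by (intro pos_meas_integral_pos w f pos_meas_mult)+
  have i1: "integrable M w" and i2: "integrable M (\<lambda>x. w x * f x)"
    and i3: "integrable M (\<lambda>x. w x * ln (f x))"
    using w f by (auto intro!: bdd_meas_integrable bdd_pos_meas_intros intro: pos_meas_imp_bdd_meas)
  have "(\<integral>x. w x * ln (f x) + ln (T / S) * w x \<partial>M) \<le> (\<integral>x. (T / S) * (w x * f x) - w x \<partial>M)"
  proof (rule integral_mono)
    fix x assume x: "x \<in> space M"
    have pos: "w x > 0" "f x > 0" using x w f by (auto intro: pos_meas_pos)
    have "ln (f x * (T / S)) \<le> f x * (T / S) - 1"
      using pos T S by (intro ln_le_minus_one) auto
    also have "ln (f x * (T / S)) = ln (f x) + ln (T / S)"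
      using pos T S by (intro ln_mult_pos) auto
    finally have "w x * (ln (f x) + ln (T / S)) \<le> w x * (f x * (T / S) - 1)"
      using pos by simp
    then show "w x * ln (f x) + ln (T / S) * w x \<le> (T / S) * (w x * f x) - w x"
      by (simp add: algebra_simps)
  qed (use i1 i2 i3 in auto)
  also have "(\<integral>x. (T / S) * (w x * f x) - w x \<partial>M) = (T / S) * S - T"
    using i1 i2 by (simp add: T_def S_def)
  also have "\<dots> = 0" using S by simp
  also have "(\<integral>x. w x * ln (f x) + ln (T / S) * w x \<partial>M)
      = (\<integral>x. w x * ln (f x) \<partial>M) + ln (T / S) * T"
    using i1 i3 by (simp add: T_def)
  also have "ln (T / S) = - ln (S / T)" using T S by (simp add: ln_div)
  finally show ?thesis unfolding T_def S_def by (simp add: mult.commute)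
qed

text \<open>Convexity of \<open>u ln u\<close>, obtained from Jensen with \<open>f = 1 / w\<close>,
  because \<open>w * f\<close> then integrates to one.\<close>

lemma integral_mult_ln_self_ge:
  assumes w: "pos_meas M w"
  shows "(\<integral>x. w x \<partial>M) * ln (\<integral>x. w x \<partial>M) \<le> (\<integral>x. w x * ln (w x) \<partial>M)"
proof -
  have T: "0 < (\<integral>x. w x \<partial>M)" using w by (rule pos_meas_integral_pos)
  have e1: "(\<integral>x. w x * ln (inverse (w x)) \<partial>M) = - (\<integral>x. w x * ln (w x) \<partial>M)"
    unfolding Bochner_Integration.integral_minus[symmetric]
    by (intro Bochner_Integration.integral_cong) (auto simp: ln_inverse dest: pos_meas_pos[OF w])
  have e2: "(\<integral>x. w x * inverse (w x) \<partial>M) = (\<integral>x. 1 \<partial>M)"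
    by (intro Bochner_Integration.integral_cong) (auto dest: pos_meas_pos[OF w])
  show ?thesis
    using ln_integral_ge[OF w pos_meas_inverse[OF w]] T unfolding e1 e2
    by (simp add: prob_space ln_div)
qed

lemma integral2_eq_pair:
  assumes "bdd_meas (M \<Otimes>\<^sub>M M) (\<lambda>p. F (fst p) (snd p))"
  shows "(\<integral>x. \<integral>y. F x y \<partial>M \<partial>M) = (\<integral>p. F (fst p) (snd p) \<partial>(M \<Otimes>\<^sub>M M))"
proof -
  interpret P: pair_prob_space M M ..
  show ?thesis
    using P.integral_fst'[OF P.bdd_meas_integrable[OF assms]] by simp
qed

lemma ln_integral2_ge:
  assumes w: "pos_meas (M \<Otimes>\<^sub>M M) (\<lambda>p. w (fst p) (snd p))"
    and f: "pos_meas (M \<Otimes>\<^sub>M M) (\<lambda>p. f (fst p) (snd p))"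
  shows "(\<integral>x. \<integral>y. w x y * ln (f x y) \<partial>M \<partial>M)
           \<le> (\<integral>x. \<integral>y. w x y \<partial>M \<partial>M) *
              ln ((\<integral>x. \<integral>y. w x y * f x y \<partial>M \<partial>M) / (\<integral>x. \<integral>y. w x y \<partial>M \<partial>M))"
proof -
  interpret P: pair_prob_space M M ..
  have w': "bdd_meas (M \<Otimes>\<^sub>M M) (\<lambda>p. w (fst p) (snd p))"
    using w by (rule pos_meas_imp_bdd_meas)
  have eq: "(\<integral>x. \<integral>y. w x y \<partial>M \<partial>M) = (\<integral>p. w (fst p) (snd p) \<partial>(M \<Otimes>\<^sub>M M))"
    "(\<integral>x. \<integral>y. w x y * ln (f x y) \<partial>M \<partial>M)
       = (\<integral>p. w (fst p) (snd p) * ln (f (fst p) (snd p)) \<partial>(M \<Otimes>\<^sub>M M))"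
    "(\<integral>x. \<integral>y. w x y * f x y \<partial>M \<partial>M)
       = (\<integral>p. w (fst p) (snd p) * f (fst p) (snd p) \<partial>(M \<Otimes>\<^sub>M M))"
    by (intro integral2_eq_pair w' bdd_meas_mult bdd_meas_ln pos_meas_imp_bdd_meas[OF f] f)+
  show ?thesis unfolding eq by (rule P.ln_integral_ge[OF w f])
qed

end

section \<open>Closed walks in a positive kernel\<close>

text \<open>The intended instance is a graphon truncated from below by a positive constant. The
  bound \<open>A_le_1\<close> is what permits deleting an edge from a density.\<close>

locale pos_kernel = prob_space M for M :: "'a measure" +
  fixes A :: "'a \<Rightarrow> 'a \<Rightarrow> real"
  assumes pos_meas_A: "pos_meas (M \<Otimes>\<^sub>M M) (\<lambda>p. A (fst p) (snd p))"
    and A_sym: "\<And>x y. x \<in> space M \<Longrightarrow> y \<in> space M \<Longrightarrow> A x y = A y x"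
    and A_le_1: "\<And>x y. x \<in> space M \<Longrightarrow> y \<in> space M \<Longrightarrow> A x y \<le> 1"
begin

text \<open>The \<open>n\<close>-fold iterated kernel for \<open>n \<ge> 1\<close>; the value at \<open>0\<close> is junk, as the identity
  has no kernel.\<close>

fun K :: "nat \<Rightarrow> 'a \<Rightarrow> 'a \<Rightarrow> real" where
  "K 0 = A"
| "K (Suc 0) = A"
| "K (Suc (Suc n)) = (\<lambda>x z. \<integral>y. A x y * K (Suc n) y z \<partial>M)"

lemma K_Suc: "1 \<le> n \<Longrightarrow> K (Suc n) x z = (\<integral>y. A x y * K n y z \<partial>M)"
  by (cases n) auto

lemma pos_meas_A': "f \<in> measurable L M \<Longrightarrow> g \<in> measurable L M \<Longrightarrow> pos_meas L (\<lambda>w. A (f w) (g w))"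
  by (rule pos_meas_compose2[OF pos_meas_A])

lemma pos_meas_K_pair: "pos_meas (M \<Otimes>\<^sub>M M) (\<lambda>p. K n (fst p) (snd p))"
proof (induction n rule: K.induct)
  case (3 n)
  have "pos_meas (M \<Otimes>\<^sub>M M)
      (\<lambda>p. \<integral>y. (\<lambda>p y. A (fst p) y * K (Suc n) y (snd p)) p y \<partial>M)"
    by (intro pos_meas_integral)
      (auto intro!: pos_meas_mult pos_meas_A' pos_meas_compose2[OF 3])
  then show ?case by simp
qed (use pos_meas_A in auto)

lemma pos_meas_K: "f \<in> measurable L M \<Longrightarrow> g \<in> measurable L M \<Longrightarrow> pos_meas L (\<lambda>w. K n (f w) (g w))"
  by (rule pos_meas_compose2[OF pos_meas_K_pair])

lemmas bdd_pos_intros = bdd_pos_meas_intros pos_meas_A' pos_meas_K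
  pos_meas_imp_bdd_meas[OF pos_meas_A'] pos_meas_imp_bdd_meas[OF pos_meas_K]

lemma K_pos: "x \<in> space M \<Longrightarrow> y \<in> space M \<Longrightarrow> 0 < K n x y"
  using pos_meas_pos[OF pos_meas_K_pair, of "(x, y)"] by (simp add: space_pair_measure)

lemma A_pos: "x \<in> space M \<Longrightarrow> y \<in> space M \<Longrightarrow> 0 < A x y"
  using K_pos[of x y 0] by simp

text \<open>Chapman-Kolmogorov: a walk is cut at its \<open>a\<close>-th vertex. The induction peels
  off the first step, and Fubini exchanges the vertex after it with the cut vertex.\<close>

lemma K_add:
  assumes "1 \<le> a" "1 \<le> b" "x \<in> space M" "z \<in> space M"
  shows "K (a + b) x z = (\<integral>y. K a x y * K b y z \<partial>M)"
  using assms
proof (induction a arbitrary: x rule: dec_induct)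
  case base
  then show ?case by (simp add: K_Suc)
next
  case (step a)
  have "K (Suc a + b) x z = (\<integral>u. A x u * K (a + b) u z \<partial>M)"
    using step by (simp add: K_Suc)
  also have "\<dots> = (\<integral>u. \<integral>y. A x u * (K a u y * K b y z) \<partial>M \<partial>M)"
    using step by (intro Bochner_Integration.integral_cong) auto
  also have "\<dots> = (\<integral>y. \<integral>u. A x u * (K a u y * K b y z) \<partial>M \<partial>M)"
    using step by (intro bdd_meas_swap) (auto intro!: bdd_pos_intros)
  also have "\<dots> = (\<integral>y. K (Suc a) x y * K b y z \<partial>M)"
    using step by (intro Bochner_Integration.integral_cong) (auto simp: K_Suc mult.assoc[symmetric])
  finally show ?case .
qed

text \<open>Reversing the walk moves its first edge to the end, where \<open>K_add\<close> with a
  last part of length one absorbs it.\<close>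

lemma K_sym:
  assumes "x \<in> space M" "y \<in> space M"
  shows "K n x y = K n y x"
  using assms
proof (induction n arbitrary: x y rule: K.induct)
  case (3 n)
  have "K (Suc (Suc n)) x y = (\<integral>u. K (Suc n) y u * A u x \<partial>M)"
    unfolding K.simps using 3 by (intro Bochner_Integration.integral_cong) (auto simp: A_sym)
  also have "\<dots> = K (Suc n + 1) y x"
    using 3 by (subst K_add) auto
  finally show ?case by simp
qed (auto simp: A_sym)

lemma K_le_1:
  assumes "x \<in> space M" "y \<in> space M"
  shows "K n x y \<le> 1"
  using assms
proof (induction n arbitrary: x y rule: K.induct)
  case (3 n)
  have "K (Suc (Suc n)) x y \<le> (\<integral>u. 1 \<partial>M)"
    unfolding K.simps
    using 3 A_le_1 by (intro integral_mono bdd_meas_integrable)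
      (auto intro!: bdd_pos_intros mult_le_one intro: less_imp_le[OF K_pos])
  then show ?case by (simp add: prob_space)
qed (auto simp: A_le_1)

text \<open>For \<open>n \<ge> 1\<close> this is the trace of the \<open>n\<close>-th power of the
  integral operator with kernel \<open>A\<close>; for \<open>n \<ge> 3\<close> it is the density of
  the cycle with \<open>n\<close> edges.\<close>

definition tr :: "nat \<Rightarrow> real" where
  "tr n = (\<integral>z. K n z z \<partial>M)"

lemma tr_pos: "0 < tr n"
  unfolding tr_def by (rule pos_meas_integral_pos) (auto intro!: pos_meas_K)

lemma tr_le_1: "tr n \<le> 1"
proof -
  have "tr n \<le> (\<integral>u. 1 \<partial>M)"
    unfolding tr_def
    by (intro integral_mono bdd_meas_integrable) (auto intro!: bdd_pos_intros K_le_1)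
  then show ?thesis by (simp add: prob_space)
qed

text \<open>Two marked vertices cut a closed walk into arcs of lengths \<open>a\<close> and
  \<open>b\<close>.\<close>

lemma tr_add:
  assumes "1 \<le> a" "1 \<le> b"
  shows "tr (a + b) = (\<integral>z. \<integral>x. K a x z * K b x z \<partial>M \<partial>M)"
  unfolding tr_def using assms
  by (intro Bochner_Integration.integral_cong) (auto simp: K_add intro!: Bochner_Integration.integral_cong K_sym)

subsection \<open>Backtracking along an edge\<close>

text \<open>Given \<open>x\<close> and \<open>z\<close>, the weight \<open>A x y * K b y z\<close>
  is the unnormalised law of the second vertex \<open>y\<close> of a walk of length
  \<open>b + 1\<close> from \<open>x\<close> to \<open>z\<close>, and the mean of
  \<open>K c y z / K b y z\<close> under it is \<open>K (c + 1) x z / K (b + 1) x z\<close>. Jensen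
  over \<open>y\<close>, averaged over \<open>x\<close> with weight \<open>K a x z\<close>, gives
  the comparison.\<close>

lemma jensen_step:
  assumes "1 \<le> a" "1 \<le> b" "1 \<le> c"
  shows "(\<integral>z. \<integral>y. K (Suc a) y z * (K b y z * ln (K c y z / K b y z)) \<partial>M \<partial>M)
       \<le> (\<integral>z. \<integral>x. K a x z * (K (Suc b) x z * ln (K (Suc c) x z / K (Suc b) x z)) \<partial>M \<partial>M)"
proof (rule integral_mono)
  fix z assume z: "z \<in> space M"
  define f where "f y = K b y z * ln (K c y z / K b y z)" for y
  have f2: "bdd_meas (M \<Otimes>\<^sub>M M) (\<lambda>w. f (fst w))" "bdd_meas (M \<Otimes>\<^sub>M M) (\<lambda>w. f (snd w))" "bdd_meas M f"
    unfolding f_def using z by (auto intro!: bdd_pos_intros)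
  \<comment> \<open>The arc of length \<open>a + 1\<close> from \<open>y\<close> is cut after its
    first step, which exposes the neighbour \<open>x\<close>.\<close>
  have "(\<integral>y. K (Suc a) y z * f y \<partial>M) = (\<integral>y. \<integral>x. K a x z * (A x y * f y) \<partial>M \<partial>M)"
    using assms z
    by (intro Bochner_Integration.integral_cong)
      (auto simp: K_Suc A_sym mult_ac simp flip: Bochner_Integration.integral_mult_left_zero
        intro!: Bochner_Integration.integral_cong)
  also have "\<dots> = (\<integral>x. \<integral>y. K a x z * (A x y * f y) \<partial>M \<partial>M)"
    using z f2 by (intro bdd_meas_swap) (auto intro!: bdd_pos_intros)
  also have "\<dots> = (\<integral>x. K a x z * (\<integral>y. A x y * f y \<partial>M) \<partial>M)"
    by simp
  also have "\<dots> \<le> (\<integral>x. K a x z * (K (Suc b) x z * ln (K (Suc c) x z / K (Suc b) x z)) \<partial>M)"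
  proof (intro integral_mono bdd_meas_integrable mult_left_mono)
    fix x assume x: "x \<in> space M"
    have "(\<integral>y. A x y * f y \<partial>M) = (\<integral>y. (A x y * K b y z) * ln (K c y z / K b y z) \<partial>M)"
      by (simp add: f_def mult.assoc)
    also have "\<dots> \<le> (\<integral>y. A x y * K b y z \<partial>M) *
        ln ((\<integral>y. (A x y * K b y z) * (K c y z / K b y z) \<partial>M) / (\<integral>y. A x y * K b y z \<partial>M))"
      using x z by (intro ln_integral_ge) (auto intro!: bdd_pos_intros)
    \<comment> \<open>The factor \<open>K b y z\<close> cancels: the part of the walk after
      \<open>y\<close> now has length \<open>c\<close> in place of \<open>b\<close>.\<close>
    also have "(\<integral>y. (A x y * K b y z) * (K c y z / K b y z) \<partial>M) = (\<integral>y. A x y * K c y z \<partial>M)"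
      using x z K_pos by (intro Bochner_Integration.integral_cong) (auto simp: less_imp_neq[symmetric])
    finally show "(\<integral>y. A x y * f y \<partial>M) \<le> K (Suc b) x z * ln (K (Suc c) x z / K (Suc b) x z)"
      using assms by (simp add: K_Suc)
    show "0 \<le> K a x z" using x z K_pos by (simp add: less_imp_le)
  next
    show "bdd_meas M (\<lambda>x. K a x z * (\<integral>y. A x y * f y \<partial>M))"
      using z f2 by (intro bdd_meas_mult bdd_meas_integral) (auto intro!: bdd_pos_intros)
  qed (use z in \<open>auto intro!: bdd_pos_intros\<close>)
  finally show "(\<integral>y. K (Suc a) y z * (K b y z * ln (K c y z / K b y z)) \<partial>M)
      \<le> (\<integral>x. K a x z * (K (Suc b) x z * ln (K (Suc c) x z / K (Suc b) x z)) \<partial>M)"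
    by (simp add: f_def)
qed (auto intro!: bdd_meas_integrable bdd_meas_integral bdd_pos_intros)

text \<open>For a random closed \<open>n\<close>-walk \<open>X\<close> with density proportional to its weight, this is \<open>tr n\<close>
  times the expectation of \<open>ln (K c X\<^sub>0 X\<^sub>a)\<close>.\<close>

definition G :: "nat \<Rightarrow> nat \<Rightarrow> nat \<Rightarrow> real" where
  "G n a c = (\<integral>z. \<integral>x. K a x z * K (n - a) x z * ln (K c x z) \<partial>M \<partial>M)"

lemma G_sym: "a \<le> n \<Longrightarrow> G n (n - a) c = G n a c"
  unfolding G_def by (simp add: mult.commute)

lemma G_diff:
  "G n a c - G n a d = (\<integral>z. \<integral>x. K a x z * K (n - a) x z * ln (K c x z / K d x z) \<partial>M \<partial>M)"
proof -
  have "G n a c - G n a d = (\<integral>z. (\<integral>x. K a x z * K (n - a) x z * ln (K c x z) \<partial>M)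
      - (\<integral>x. K a x z * K (n - a) x z * ln (K d x z) \<partial>M) \<partial>M)"
    unfolding G_def
    by (intro Bochner_Integration.integral_diff[symmetric] bdd_meas_integrable bdd_meas_integral)
      (auto intro!: bdd_pos_intros)
  also have "\<dots> = (\<integral>z. \<integral>x. K a x z * K (n - a) x z * ln (K c x z)
      - K a x z * K (n - a) x z * ln (K d x z) \<partial>M \<partial>M)"
    by (intro Bochner_Integration.integral_cong refl Bochner_Integration.integral_diff[symmetric]
        bdd_meas_integrable)
      (auto intro!: bdd_pos_intros)
  also have "\<dots> = (\<integral>z. \<integral>x. K a x z * K (n - a) x z * ln (K c x z / K d x z) \<partial>M \<partial>M)"
    by (intro Bochner_Integration.integral_cong refl) (simp add: ln_div less_imp_neq[OF K_pos, symmetric] algebra_simps)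
  finally show ?thesis .
qed

text \<open>This is \<open>jensen_step\<close> with \<open>b = n - a - 1\<close>. The marked vertex
  moves along one edge of the cycle; the substituted walk and the arc it is compared with both grow
  by one step.\<close>

lemma G_step:
  assumes "1 \<le> a" "a + 2 \<le> n" "1 \<le> c"
  shows "G n (Suc a) c - G n (Suc a) (n - Suc a) \<le> G n a (Suc c) - G n a (n - a)"
proof -
  obtain b where b: "n = a + Suc b" "1 \<le> b"
    using assms by (intro that[of "n - Suc a"]) auto
  show ?thesis
    using jensen_step[OF assms(1) b(2) assms(3)] unfolding G_diff b(1) by (simp add: mult.assoc)
qed

text \<open>The two additional steps cross the edge between positions \<open>a\<close> and
  \<open>a + 1\<close> forth and back: \<open>G_step\<close> is used once from the opposite side,
  through \<open>G_sym\<close>, and once directly. The correction is a difference of one expression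
  at \<open>a\<close> and at \<open>Suc a\<close>, which prepares the telescoping.\<close>

lemma G_two_steps:
  assumes "1 \<le> a" "a + 2 \<le> n" "1 \<le> c"
  shows "G n a c + (G n a (n - a) - G n a a) - (G n (Suc a) (n - Suc a) - G n (Suc a) (Suc a))
           \<le> G n a (c + 2)"
proof -
  have "G n (Suc a) (Suc c) - G n (Suc a) (n - Suc a) \<le> G n a (c + 2) - G n a (n - a)"
    using G_step[of a n "Suc c"] assms by simp
  moreover have "G n a c - G n a a \<le> G n (Suc a) (Suc c) - G n (Suc a) (Suc a)"
  proof -
    have "Suc (n - Suc a) = n - a" using assms by simp
    then show ?thesis
      using G_step[of "n - Suc a" n c] G_sym[of "Suc a" n] G_sym[of a n] assms by simp
  qed
  ultimately show ?thesis by linarith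
qed

text \<open>Starting from the original arc of length \<open>n - a\<close>, the same edge is crossed
  back and forth \<open>q\<close> times; the correction in \<open>G_two_steps\<close> does not
  depend on the current length \<open>c\<close>, so it adds up linearly.\<close>

lemma G_backtrack:
  assumes "1 \<le> a" "a + 2 \<le> n"
  shows "real q * ((G n a (n - a) - G n a a) - (G n (Suc a) (n - Suc a) - G n (Suc a) (Suc a)))
           \<le> G n a (n - a + 2 * q) - G n a (n - a)"
proof (induction q)
  case (Suc q)
  have "1 \<le> n - a + 2 * q" "n - a + 2 * Suc q = n - a + 2 * q + 2" using assms by simp_all
  then show ?case
    using Suc G_two_steps[OF assms, of "n - a + 2 * q"] by (simp add: distrib_right)
qed auto

text \<open>Jensen over both marked vertices: replacing the arc of length \<open>n - a\<close> by a
  walk of length \<open>c\<close> turns the closed \<open>n\<close>-walk into a closed walk of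
  length \<open>a + c\<close>.\<close>

lemma G_le_tr:
  assumes "1 \<le> a" "a < n" "1 \<le> c"
  shows "G n a c - G n a (n - a) \<le> tr n * ln (tr (a + c) / tr n)"
proof -
  have "G n a c - G n a (n - a) \<le> (\<integral>z. \<integral>x. K a x z * K (n - a) x z \<partial>M \<partial>M) *
     ln ((\<integral>z. \<integral>x. K a x z * K (n - a) x z * (K c x z / K (n - a) x z) \<partial>M \<partial>M) /
         (\<integral>z. \<integral>x. K a x z * K (n - a) x z \<partial>M \<partial>M))"
    unfolding G_diff by (intro ln_integral2_ge) (auto intro!: bdd_pos_intros)
  also have "(\<integral>z. \<integral>x. K a x z * K (n - a) x z * (K c x z / K (n - a) x z) \<partial>M \<partial>M)
      = (\<integral>z. \<integral>x. K a x z * K c x z \<partial>M \<partial>M)"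
    by (intro Bochner_Integration.integral_cong refl) (simp add: K_pos less_imp_neq[symmetric])
  finally show ?thesis
    using tr_add[of a "n - a"] tr_add[of a c] assms by simp
qed

text \<open>Each of the \<open>n - 2\<close> edges not at the apex may be traversed \<open>2 q\<close> more times; the losses
  telescope when summed over these edges.\<close>

lemma tr_backtrack_ge:
  assumes "3 \<le> n"
  shows "2 * real q * G n 1 (n - 1) \<le> real (n - 2) * (tr n * ln (tr (n + 2 * q) / tr n))"
proof -
  \<comment> \<open>\<open>\<Phi>\<close> compares the two arcs between the marked vertices.
    Exchanging the arcs changes its sign, so the telescoped sum becomes
    \<open>2 * \<Phi> 1\<close>.\<close>
  define \<Phi> where "\<Phi> a = G n a (n - a) - G n a a" for a
  have "real q * (\<Phi> a - \<Phi> (Suc a)) \<le> tr n * ln (tr (n + 2 * q) / tr n)" if "a \<in> {1..<n - 1}" for a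
  proof -
    have "a + (n - a + 2 * q) = n + 2 * q" "1 \<le> a" "a + 2 \<le> n" "a < n" "1 \<le> n - a + 2 * q"
      using that by auto
    then show ?thesis
      using G_backtrack[of a n q] G_le_tr[of a n "n - a + 2 * q"] unfolding \<Phi>_def by simp
  qed
  then have "(\<Sum>a = 1..<n - 1. real q * (\<Phi> a - \<Phi> (Suc a)))
      \<le> (\<Sum>a = 1..<n - 1. tr n * ln (tr (n + 2 * q) / tr n))"
    by (rule sum_mono)
  also have "(\<Sum>a = 1..<n - 1. real q * (\<Phi> a - \<Phi> (Suc a))) = real q * (\<Phi> 1 - \<Phi> (n - 1))"
    using assms sum_Suc_diff'[of 1 "n - 1" "\<lambda>a. - \<Phi> a"] by (simp add: sum_distrib_left[symmetric])
  also have "\<Phi> (n - 1) = - \<Phi> 1"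
    unfolding \<Phi>_def using assms G_sym[of 1 n] by simp
  finally have "2 * real q * \<Phi> 1 \<le> real (n - 2) * (tr n * ln (tr (n + 2 * q) / tr n))"
    by (simp add: Suc_diff_Suc numeral_2_eq_2)
  \<comment> \<open>Since \<open>A \<le> 1\<close>, the logarithm here is nonpositive, and passing
    from \<open>\<Phi> 1\<close> to \<open>G n 1 (n - 1)\<close> only weakens the bound.\<close>
  moreover have "G n 1 1 \<le> 0"
  proof -
    have "G n 1 1 \<le> (\<integral>z. 0 \<partial>M)"
      unfolding G_def
    proof (intro integral_mono bdd_meas_integrable)
      fix z assume z: "z \<in> space M"
      have "(\<integral>x. K 1 x z * K (n - 1) x z * ln (K 1 x z) \<partial>M) \<le> (\<integral>x. 0 \<partial>M)"
        using z K_pos A_pos A_le_1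
        by (intro integral_mono bdd_meas_integrable mult_nonneg_nonpos)
           (auto intro!: bdd_pos_intros mult_nonneg_nonneg simp: less_imp_le)
      then show "(\<integral>x. K 1 x z * K (n - 1) x z * ln (K 1 x z) \<partial>M) \<le> 0" by simp
    qed (auto intro!: bdd_meas_integral bdd_pos_intros)
    then show ?thesis by simp
  qed
  ultimately show ?thesis
    unfolding \<Phi>_def
    by (smt (verit) mult_nonneg_nonpos of_nat_0_le_iff right_diff_distrib')
qed

subsection \<open>Gluing an even cycle along an edge\<close>


text \<open>The edge and vertex marginals of the closed \<open>(b + 1)\<close>-walk density, not normalised, and the
  transition density of \<open>l + 1\<close> (not \<open>l\<close>) steps of the Markov chain with this edge law.\<close>

definition edge_density :: "nat \<Rightarrow> 'a \<Rightarrow> 'a \<Rightarrow> real" where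
  "edge_density b x y = A x y * K b x y"

definition vertex_density :: "nat \<Rightarrow> 'a \<Rightarrow> real" where
  "vertex_density b x = (\<integral>y. edge_density b x y \<partial>M)"

primrec walk_kernel :: "nat \<Rightarrow> nat \<Rightarrow> 'a \<Rightarrow> 'a \<Rightarrow> real" where
  "walk_kernel b 0 = (\<lambda>x y. edge_density b x y / vertex_density b x)"
| "walk_kernel b (Suc l) =
     (\<lambda>x z. \<integral>y. edge_density b x y / vertex_density b x * walk_kernel b l y z \<partial>M)"

lemma pos_meas_edge_density:
  "f \<in> measurable L M \<Longrightarrow> g \<in> measurable L M \<Longrightarrow> pos_meas L (\<lambda>w. edge_density b (f w) (g w))"
  unfolding edge_density_def by (intro bdd_pos_intros)

lemma pos_meas_vertex_density:
  assumes "f \<in> measurable L M"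
  shows "pos_meas L (\<lambda>w. vertex_density b (f w))"
proof -
  have "pos_meas M (vertex_density b)"
    unfolding vertex_density_def by (intro pos_meas_integral pos_meas_edge_density) auto
  then show ?thesis using assms by (rule pos_meas_compose)
qed

lemma pos_meas_walk_kernel:
  assumes "f \<in> measurable L M" "g \<in> measurable L M"
  shows "pos_meas L (\<lambda>w. walk_kernel b l (f w) (g w))"
proof -
  have "pos_meas (M \<Otimes>\<^sub>M M) (\<lambda>p. walk_kernel b l (fst p) (snd p))"
  proof (induction l)
    case (Suc l)
    have "pos_meas (M \<Otimes>\<^sub>M M)
        (\<lambda>p. \<integral>y. (\<lambda>p y. edge_density b (fst p) y / vertex_density b (fst p)
                 * walk_kernel b l y (snd p)) p y \<partial>M)"
      by (intro pos_meas_integral)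
        (auto intro!: bdd_pos_intros pos_meas_edge_density pos_meas_vertex_density
          pos_meas_compose2[OF Suc])
    then show ?case by simp
  qed (auto intro!: bdd_pos_intros pos_meas_edge_density pos_meas_vertex_density)
  then show ?thesis using assms by (rule pos_meas_compose2)
qed

lemmas bdd_pos_walk_intros = bdd_pos_intros
  pos_meas_edge_density pos_meas_vertex_density pos_meas_walk_kernel
  pos_meas_imp_bdd_meas[OF pos_meas_edge_density]
  pos_meas_imp_bdd_meas[OF pos_meas_vertex_density]
  pos_meas_imp_bdd_meas[OF pos_meas_walk_kernel]

section \<open>Stationarity of the chain with the given edge law\<close>

lemma edge_density_pos: "x \<in> space M \<Longrightarrow> y \<in> space M \<Longrightarrow> 0 < edge_density b x y"
  unfolding edge_density_def by (simp add: A_pos K_pos)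

lemma edge_density_sym: "x \<in> space M \<Longrightarrow> y \<in> space M \<Longrightarrow> edge_density b x y = edge_density b y x"
  unfolding edge_density_def by (simp add: A_sym K_sym)

lemma vertex_density_pos: "x \<in> space M \<Longrightarrow> 0 < vertex_density b x"
  by (rule pos_meas_pos[OF pos_meas_vertex_density]) auto

lemma walk_kernel_pos: "x \<in> space M \<Longrightarrow> y \<in> space M \<Longrightarrow> 0 < walk_kernel b l x y"
  using pos_meas_pos[OF pos_meas_walk_kernel[OF measurable_ident measurable_const]] by auto

text \<open>One step has total probability one because \<open>vertex_density\<close> is the row
  integral of \<open>edge_density\<close>. For more steps the final vertex is integrated out
  first.\<close>

lemma integral_walk_kernel:
  "x \<in> space M \<Longrightarrow> (\<integral>z. walk_kernel b l x z \<partial>M) = 1"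
proof (induction l arbitrary: x)
  case 0
  then show ?case
    using vertex_density_pos[OF 0, of b] by (simp add: vertex_density_def[symmetric])
next
  case (Suc l)
  let ?P = "walk_kernel b 0"
  have "(\<integral>z. walk_kernel b (Suc l) x z \<partial>M) = (\<integral>y. \<integral>z. ?P x y * walk_kernel b l y z \<partial>M \<partial>M)"
    unfolding walk_kernel.simps using Suc.prems
    by (intro bdd_meas_swap) (auto intro!: bdd_pos_walk_intros)
  also have "\<dots> = (\<integral>y. ?P x y \<partial>M)"
    by (intro Bochner_Integration.integral_cong) (auto simp: Suc.IH)
  also have "\<dots> = 1"
    using vertex_density_pos[OF Suc.prems, of b] by (simp add: vertex_density_def[symmetric])
  finally show ?case .
qed

lemma edge_density_walk_kernel:
  assumes "x \<in> space M"
  shows "vertex_density b x * walk_kernel b 0 x y = edge_density b x y"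
  using vertex_density_pos[OF assms, of b] by simp

lemma edge_density_walk_kernel_Suc:
  assumes "x \<in> space M"
  shows "vertex_density b x * walk_kernel b (Suc l) x z = (\<integral>y. edge_density b x y * walk_kernel b l y z \<partial>M)"
  using vertex_density_pos[OF assms, of b] by simp

text \<open>Symmetry of the edge law makes \<open>vertex_density\<close> stationary, so every step
  of the chain has the same edge law.\<close>

lemma integral_edge_density:
  assumes "y \<in> space M"
  shows "(\<integral>x. edge_density b x y \<partial>M) = vertex_density b y"
  unfolding vertex_density_def using assms
  by (intro Bochner_Integration.integral_cong) (auto simp: edge_density_sym)

lemma integral_vertex_density: "1 \<le> b \<Longrightarrow> (\<integral>x. vertex_density b x \<partial>M) = tr (Suc b)"
  using tr_add[of 1 b] unfolding vertex_density_def edge_density_def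
  by (auto intro!: Bochner_Integration.integral_cong simp: A_sym K_sym)

text \<open>Minus the relative entropy of the vertex reached after \<open>l + 1\<close> chain steps
  with respect to the kernel \<open>K (l + 1)\<close>, averaged over the start with the unnormalised
  density \<open>vertex_density b\<close>.\<close>

definition walk_entropy :: "nat \<Rightarrow> nat \<Rightarrow> real" where
  "walk_entropy b l = (\<integral>x. \<integral>z. vertex_density b x *
     (walk_kernel b l x z * ln (K (Suc l) x z / walk_kernel b l x z)) \<partial>M \<partial>M)"

text \<open>The sign is that of \<open>u ln u\<close>, opposite to differential entropy.\<close>

definition vertex_entropy :: "nat \<Rightarrow> real" where
  "vertex_entropy b = (\<integral>x. vertex_density b x * ln (vertex_density b x) \<partial>M)"

text \<open>For a single step, \<open>A\<close> divided by the transition density is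
  \<open>vertex_density b x / K b x z\<close>; its logarithm splits into a vertex term and the edge
  expectation recorded by \<open>G\<close>.\<close>

lemma walk_entropy_0:
  assumes "1 \<le> b"
  shows "walk_entropy b 0 = vertex_entropy b - G (Suc b) 1 b"
proof -
  have "walk_entropy b 0
      = (\<integral>x. \<integral>z. edge_density b x z * ln (vertex_density b x) - edge_density b x z * ln (K b x z) \<partial>M \<partial>M)"
    unfolding walk_entropy_def
  proof (intro Bochner_Integration.integral_cong refl)
    fix x z assume xz: "x \<in> space M" "z \<in> space M"
    have p: "0 < A x z" "0 < K b x z" "0 < vertex_density b x"
      using xz by (auto intro: A_pos K_pos vertex_density_pos)
    have e: "K (Suc 0) x z / walk_kernel b 0 x z = vertex_density b x / K b x z"
      using p by (simp add: edge_density_def)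
    show "vertex_density b x * (walk_kernel b 0 x z * ln (K (Suc 0) x z / walk_kernel b 0 x z))
        = edge_density b x z * ln (vertex_density b x) - edge_density b x z * ln (K b x z)"
      unfolding e using p by (simp add: ln_div right_diff_distrib)
  qed
  also have "\<dots> = (\<integral>x. (\<integral>z. edge_density b x z * ln (vertex_density b x) \<partial>M)
      - (\<integral>z. edge_density b x z * ln (K b x z) \<partial>M) \<partial>M)"
    by (intro Bochner_Integration.integral_cong refl Bochner_Integration.integral_diff bdd_meas_integrable)
      (auto intro!: bdd_pos_walk_intros)
  also have "\<dots> = (\<integral>x. \<integral>z. edge_density b x z * ln (vertex_density b x) \<partial>M \<partial>M)
      - (\<integral>x. \<integral>z. edge_density b x z * ln (K b x z) \<partial>M \<partial>M)"
    by (intro Bochner_Integration.integral_diff bdd_meas_integrable bdd_meas_integral)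
      (auto intro!: bdd_pos_walk_intros)
  also have "(\<integral>x. \<integral>z. edge_density b x z * ln (vertex_density b x) \<partial>M \<partial>M) = vertex_entropy b"
    unfolding vertex_entropy_def by (simp add: vertex_density_def[symmetric])
  also have "(\<integral>x. \<integral>z. edge_density b x z * ln (K b x z) \<partial>M \<partial>M) = G (Suc b) 1 b"
    unfolding G_def edge_density_def
    by (intro Bochner_Integration.integral_cong refl) (auto simp: A_sym K_sym)
  finally show ?thesis .
qed

text \<open>By stationarity the left side is an expected log-ratio along a chain path through
  \<open>x\<close>, \<open>y\<close>, \<open>z\<close>, with one step before \<open>y\<close> and
  \<open>l + 1\<close> after it. Forgetting \<open>y\<close> can only increase it, by Jensen over
  \<open>y\<close> with the ends fixed.\<close>

lemma walk_entropy_Suc: "walk_entropy b 0 + walk_entropy b l \<le> walk_entropy b (Suc l)"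
proof -
  let ?P = "walk_kernel b 0"
  let ?m = "vertex_density b"
  let ?u = "\<lambda>x y. ln (A x y / ?P x y)"
  let ?v = "\<lambda>y z. ln (K (Suc l) y z / walk_kernel b l y z)"
  define V where "V y = (\<integral>z. walk_kernel b l y z * ?v y z \<partial>M)" for y
  have V0: "bdd_meas M V"
    unfolding V_def by (rule bdd_meas_integral) (auto intro!: bdd_pos_walk_intros simp del: walk_kernel.simps)
  have V: "bdd_meas (M \<Otimes>\<^sub>M M) (\<lambda>p. V (snd p))" "bdd_meas M V"
    using V0 measurable_snd[of M M] unfolding bdd_meas_def
    by (auto simp: space_pair_measure intro: measurable_compose)
  have "walk_entropy b 0 + walk_entropy b l
      = (\<integral>x. \<integral>y. ?m x * (?P x y * ?u x y) \<partial>M \<partial>M) + (\<integral>y. ?m y * V y \<partial>M)"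
    by (simp add: walk_entropy_def V_def del: walk_kernel.simps)
  \<comment> \<open>The start \<open>y\<close> of the longer piece is realised as the vertex reached
    from \<open>x\<close> in one step.\<close>
  also have "(\<integral>y. ?m y * V y \<partial>M) = (\<integral>y. \<integral>x. ?m x * (?P x y * V y) \<partial>M \<partial>M)"
    by (intro Bochner_Integration.integral_cong refl)
       (simp add: mult.assoc[symmetric] edge_density_walk_kernel integral_edge_density
          cong: Bochner_Integration.integral_cong del: walk_kernel.simps)
  also have "\<dots> = (\<integral>x. \<integral>y. ?m x * (?P x y * V y) \<partial>M \<partial>M)"
    by (intro bdd_meas_swap[symmetric]) (auto intro!: bdd_pos_walk_intros V simp del: walk_kernel.simps)
  also have "(\<integral>x. \<integral>y. ?m x * (?P x y * ?u x y) \<partial>M \<partial>M) + \<dots>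
      = (\<integral>x. (\<integral>y. ?m x * (?P x y * ?u x y) \<partial>M) + (\<integral>y. ?m x * (?P x y * V y) \<partial>M) \<partial>M)"
    by (intro Bochner_Integration.integral_add[symmetric] bdd_meas_integrable bdd_meas_integral)
      (auto intro!: bdd_pos_walk_intros V simp del: walk_kernel.simps)
  also have "\<dots> = (\<integral>x. \<integral>y. ?m x * (?P x y * ?u x y) + ?m x * (?P x y * V y) \<partial>M \<partial>M)"
    by (intro Bochner_Integration.integral_cong refl Bochner_Integration.integral_add[symmetric]
        bdd_meas_integrable)
      (auto intro!: bdd_pos_walk_intros V simp del: walk_kernel.simps)
  also have "\<dots> = (\<integral>x. \<integral>y. \<integral>z. ?m x * (?P x y * (walk_kernel b l y z * (?u x y + ?v y z))) \<partial>M \<partial>M \<partial>M)"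
  proof (intro Bochner_Integration.integral_cong refl)
    fix x y assume xy: "x \<in> space M" "y \<in> space M"
    have "(\<integral>z. walk_kernel b l y z * (?u x y + ?v y z) \<partial>M)
        = (\<integral>z. walk_kernel b l y z * ?u x y + walk_kernel b l y z * ?v y z \<partial>M)"
      by (simp add: distrib_left del: walk_kernel.simps)
    also have "\<dots> = (\<integral>z. walk_kernel b l y z * ?u x y \<partial>M) + V y"
      unfolding V_def using xy
      by (intro Bochner_Integration.integral_add bdd_meas_integrable)
        (auto intro!: bdd_pos_walk_intros simp del: walk_kernel.simps)
    also have "(\<integral>z. walk_kernel b l y z * ?u x y \<partial>M) = ?u x y"
      using xy by (simp add: integral_walk_kernel del: walk_kernel.simps)
    finally have "(\<integral>z. walk_kernel b l y z * (?u x y + ?v y z) \<partial>M) = ?u x y + V y" .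
    then show "?m x * (?P x y * ?u x y) + ?m x * (?P x y * V y)
        = (\<integral>z. ?m x * (?P x y * (walk_kernel b l y z * (?u x y + ?v y z))) \<partial>M)"
      unfolding Bochner_Integration.integral_mult_right_zero by (simp only: distrib_left)
  qed
  also have "\<dots> = (\<integral>x. \<integral>z. \<integral>y. ?m x * (?P x y * (walk_kernel b l y z * (?u x y + ?v y z))) \<partial>M \<partial>M \<partial>M)"
    by (intro Bochner_Integration.integral_cong refl bdd_meas_swap)
      (auto intro!: bdd_pos_walk_intros simp del: walk_kernel.simps)
  also have "\<dots> \<le> walk_entropy b (Suc l)"
    unfolding walk_entropy_def
  proof (intro integral_mono)
    fix x z assume xz: "x \<in> space M" "z \<in> space M"
    have "(\<integral>y. ?P x y * (walk_kernel b l y z * (?u x y + ?v y z)) \<partial>M)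
        = (\<integral>y. ?P x y * walk_kernel b l y z
             * ln (A x y / ?P x y * (K (Suc l) y z / walk_kernel b l y z)) \<partial>M)"
    proof (intro Bochner_Integration.integral_cong refl)
      fix y assume y: "y \<in> space M"
      have "ln (A x y / ?P x y * (K (Suc l) y z / walk_kernel b l y z)) = ?u x y + ?v y z"
        using xz y by (intro ln_mult_pos divide_pos_pos A_pos K_pos walk_kernel_pos)
      then show "?P x y * (walk_kernel b l y z * (?u x y + ?v y z)) = ?P x y * walk_kernel b l y z
             * ln (A x y / ?P x y * (K (Suc l) y z / walk_kernel b l y z))"
        by (simp add: mult.assoc del: walk_kernel.simps)
    qed
    \<comment> \<open>The weight has mass \<open>walk_kernel b (Suc l) x z\<close>, and multiplied
      by the ratio it integrates to \<open>K (l + 2) x z\<close>.\<close>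
    also have "\<dots> \<le> (\<integral>y. ?P x y * walk_kernel b l y z \<partial>M) *
        ln ((\<integral>y. ?P x y * walk_kernel b l y z * (A x y / ?P x y * (K (Suc l) y z / walk_kernel b l y z)) \<partial>M)
          / (\<integral>y. ?P x y * walk_kernel b l y z \<partial>M))"
      using xz by (intro ln_integral_ge) (auto intro!: bdd_pos_walk_intros simp del: walk_kernel.simps)
    also have "(\<integral>y. ?P x y * walk_kernel b l y z * (A x y / ?P x y * (K (Suc l) y z / walk_kernel b l y z)) \<partial>M)
        = K (Suc (Suc l)) x z"
      unfolding K.simps
    proof (intro Bochner_Integration.integral_cong refl)
      fix y assume y: "y \<in> space M"
      then have "0 < ?P x y" "0 < walk_kernel b l y z" using xz by (auto intro: walk_kernel_pos simp del: walk_kernel.simps)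
      then show "?P x y * walk_kernel b l y z * (A x y / ?P x y * (K (Suc l) y z / walk_kernel b l y z))
          = A x y * K (Suc l) y z"
        by (simp del: walk_kernel.simps)
    qed
    finally have "(\<integral>y. ?P x y * (walk_kernel b l y z * (?u x y + ?v y z)) \<partial>M)
      \<le> walk_kernel b (Suc l) x z * ln (K (Suc (Suc l)) x z / walk_kernel b (Suc l) x z)"
      by simp
    then show "(\<integral>y. ?m x * (?P x y * (walk_kernel b l y z * (?u x y + ?v y z))) \<partial>M)
      \<le> ?m x * (walk_kernel b (Suc l) x z * ln (K (Suc (Suc l)) x z / walk_kernel b (Suc l) x z))"
      using xz vertex_density_pos[OF xz(1), of b] by (simp del: walk_kernel.simps K.simps)
  qed (auto intro!: bdd_meas_integrable bdd_meas_integral bdd_pos_walk_intros simp del: walk_kernel.simps K.simps)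
  finally show ?thesis .
qed

lemma walk_entropy_ge: "real (Suc l) * walk_entropy b 0 \<le> walk_entropy b l"
proof (induction l)
  case (Suc l)
  then show ?case using walk_entropy_Suc[of b l] by (simp add: algebra_simps)
qed simp

text \<open>The joint density of the two ends has total mass \<open>tr (Suc b)\<close>, so convexity
  of \<open>u ln u\<close> bounds its entropy integral. The logarithm of this product density splits
  off \<open>vertex_entropy\<close>.\<close>

lemma walk_kernel_self_entropy_ge:
  assumes "1 \<le> b"
  shows "tr (Suc b) * ln (tr (Suc b)) - vertex_entropy b
     \<le> (\<integral>x. \<integral>z. vertex_density b x * (walk_kernel b l x z * ln (walk_kernel b l x z)) \<partial>M \<partial>M)"
proof -
  interpret P: pair_prob_space M M ..
  let ?m = "vertex_density b"
  let ?w = "\<lambda>x z. ?m x * walk_kernel b l x z"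
  have w: "pos_meas (M \<Otimes>\<^sub>M M) (\<lambda>p. ?w (fst p) (snd p))"
    by (auto intro!: bdd_pos_walk_intros)
  have 1: "(\<integral>p. ?w (fst p) (snd p) \<partial>(M \<Otimes>\<^sub>M M)) = tr (Suc b)"
  proof -
    have "(\<integral>p. ?w (fst p) (snd p) \<partial>(M \<Otimes>\<^sub>M M)) = (\<integral>x. \<integral>z. ?w x z \<partial>M \<partial>M)"
      using w by (intro integral2_eq_pair[symmetric] pos_meas_imp_bdd_meas)
    also have "\<dots> = (\<integral>x. ?m x \<partial>M)"
      by (intro Bochner_Integration.integral_cong) (auto simp: integral_walk_kernel)
    finally show ?thesis using assms by (simp add: integral_vertex_density)
  qed
  have "tr (Suc b) * ln (tr (Suc b))
      \<le> (\<integral>p. ?w (fst p) (snd p) * ln (?w (fst p) (snd p)) \<partial>(M \<Otimes>\<^sub>M M))"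
    using P.integral_mult_ln_self_ge[OF w] unfolding 1 .
  also have "\<dots> = (\<integral>x. \<integral>z. ?w x z * ln (?w x z) \<partial>M \<partial>M)"
    by (intro integral2_eq_pair[symmetric]) (auto intro!: bdd_pos_walk_intros)
  also have "\<dots> = (\<integral>x. \<integral>z. ?m x * ln (?m x) * walk_kernel b l x z
      + ?m x * (walk_kernel b l x z * ln (walk_kernel b l x z)) \<partial>M \<partial>M)"
    by (intro Bochner_Integration.integral_cong refl)
      (simp add: ln_mult_pos vertex_density_pos walk_kernel_pos algebra_simps)
  also have "\<dots> = (\<integral>x. ?m x * ln (?m x)
      + (\<integral>z. ?m x * (walk_kernel b l x z * ln (walk_kernel b l x z)) \<partial>M) \<partial>M)"
  proof (intro Bochner_Integration.integral_cong refl)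
    fix x assume x: "x \<in> space M"
    have "(\<integral>z. ?m x * ln (?m x) * walk_kernel b l x z
      + ?m x * (walk_kernel b l x z * ln (walk_kernel b l x z)) \<partial>M)
      = (\<integral>z. ?m x * ln (?m x) * walk_kernel b l x z \<partial>M)
      + (\<integral>z. ?m x * (walk_kernel b l x z * ln (walk_kernel b l x z)) \<partial>M)"
      using x by (intro Bochner_Integration.integral_add bdd_meas_integrable) (auto intro!: bdd_pos_walk_intros)
    then show "(\<integral>z. ?m x * ln (?m x) * walk_kernel b l x z
      + ?m x * (walk_kernel b l x z * ln (walk_kernel b l x z)) \<partial>M)
      = ?m x * ln (?m x) + (\<integral>z. ?m x * (walk_kernel b l x z * ln (walk_kernel b l x z)) \<partial>M)"
      using x by (simp add: integral_walk_kernel)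
  qed
  also have "\<dots> = vertex_entropy b
      + (\<integral>x. \<integral>z. ?m x * (walk_kernel b l x z * ln (walk_kernel b l x z)) \<partial>M \<partial>M)"
    unfolding vertex_entropy_def
    by (intro Bochner_Integration.integral_add bdd_meas_integrable bdd_meas_integral)
      (auto intro!: bdd_pos_walk_intros)
  finally show ?thesis by simp
qed

text \<open>An even cycle of length \<open>2 l + 4\<close>, made of two conditionally independent walks with common
  ends, is glued along an edge to a closed \<open>(b + 1)\<close>-walk.\<close>

lemma tr_glue_ge_entropy:
  assumes "1 \<le> b"
  shows "walk_entropy b l
      + (\<integral>x. \<integral>z. vertex_density b x * (walk_kernel b (Suc l) x z * ln (K (l + 2) x z)) \<partial>M \<partial>M)
     \<le> tr (Suc b) * ln (tr (b + (2 * l + 3)) / tr (Suc b))"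
proof -
  let ?g = "edge_density b"
  let ?m = "vertex_density b"
  let ?w = "walk_kernel b l"
  let ?c = "2 * l + 3"
  let ?v = "\<lambda>y z. ln (K (Suc l) y z / ?w y z)"
  let ?u = "\<lambda>x z. ln (K (l + 2) x z)"
  \<comment> \<open>For an edge with ends \<open>x\<close> and \<open>y\<close>, the opposite vertex
    \<open>z\<close> of the even cycle is reached from \<open>y\<close> by \<open>l + 1\<close>
    chain steps; the other side is accounted for by \<open>K (l + 2) x z\<close>.\<close>
  define V where "V y = (\<integral>z. ?w y z * ?v y z \<partial>M)" for y
  have V0: "bdd_meas M V"
    unfolding V_def by (rule bdd_meas_integral) (auto intro!: bdd_pos_walk_intros simp del: K.simps)
  have V: "bdd_meas (M \<Otimes>\<^sub>M M) (\<lambda>p. V (snd p))" "bdd_meas M V"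
    using V0 measurable_snd[of M M] unfolding bdd_meas_def
    by (auto simp: space_pair_measure intro: measurable_compose)
  have "walk_entropy b l = (\<integral>y. ?m y * V y \<partial>M)"
    by (simp add: walk_entropy_def V_def del: K.simps)
  also have "\<dots> = (\<integral>y. \<integral>x. ?g x y * V y \<partial>M \<partial>M)"
    by (intro Bochner_Integration.integral_cong refl) (simp add: integral_edge_density)
  also have "\<dots> = (\<integral>x. \<integral>y. ?g x y * V y \<partial>M \<partial>M)"
    by (intro bdd_meas_swap[symmetric]) (auto intro!: bdd_pos_walk_intros V)
  finally have 1: "walk_entropy b l = (\<integral>x. \<integral>y. ?g x y * V y \<partial>M \<partial>M)" .
  \<comment> \<open>One step from \<open>x\<close> to \<open>y\<close> and \<open>l + 1\<close>
    steps from \<open>y\<close> to \<open>z\<close> form the \<open>l + 2\<close> steps of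
    \<open>walk_kernel b (Suc l)\<close>.\<close>
  have 2: "(\<integral>x. \<integral>z. ?m x * (walk_kernel b (Suc l) x z * ?u x z) \<partial>M \<partial>M)
      = (\<integral>x. \<integral>y. ?g x y * (\<integral>z. ?w y z * ?u x z \<partial>M) \<partial>M \<partial>M)"
  proof (rule Bochner_Integration.integral_cong[OF refl])
    fix x assume x: "x \<in> space M"
    have "(\<integral>z. ?m x * (walk_kernel b (Suc l) x z * ?u x z) \<partial>M)
        = (\<integral>z. \<integral>y. ?g x y * (?w y z * ?u x z) \<partial>M \<partial>M)"
      by (simp add: mult.assoc[symmetric] edge_density_walk_kernel_Suc[OF x] del: K.simps walk_kernel.simps)
    also have "\<dots> = (\<integral>y. \<integral>z. ?g x y * (?w y z * ?u x z) \<partial>M \<partial>M)"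
      using x by (intro bdd_meas_swap) (auto intro!: bdd_pos_walk_intros simp del: K.simps)
    finally show "(\<integral>z. ?m x * (walk_kernel b (Suc l) x z * ?u x z) \<partial>M)
        = (\<integral>y. ?g x y * (\<integral>z. ?w y z * ?u x z \<partial>M) \<partial>M)" by simp
  qed
  have "walk_entropy b l
      + (\<integral>x. \<integral>z. ?m x * (walk_kernel b (Suc l) x z * ?u x z) \<partial>M \<partial>M)
    = (\<integral>x. (\<integral>y. ?g x y * V y \<partial>M) + (\<integral>y. ?g x y * (\<integral>z. ?w y z * ?u x z \<partial>M) \<partial>M) \<partial>M)"
    unfolding 1 2
    by (intro Bochner_Integration.integral_add[symmetric] bdd_meas_integrable bdd_meas_integral)
      (auto intro!: bdd_pos_walk_intros V bdd_meas_integral simp del: K.simps)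
  also have "\<dots> = (\<integral>x. \<integral>y. ?g x y * V y + ?g x y * (\<integral>z. ?w y z * ?u x z \<partial>M) \<partial>M \<partial>M)"
    by (intro Bochner_Integration.integral_cong refl Bochner_Integration.integral_add[symmetric]
        bdd_meas_integrable)
      (auto intro!: bdd_pos_walk_intros V bdd_meas_integral simp del: K.simps)
  also have "\<dots> \<le> (\<integral>x. \<integral>y. ?g x y * ln (K ?c x y) \<partial>M \<partial>M)"
  proof (intro integral_mono)
    fix x y assume xy: "x \<in> space M" "y \<in> space M"
    have "V y + (\<integral>z. ?w y z * ?u x z \<partial>M) = (\<integral>z. ?w y z * ?v y z + ?w y z * ?u x z \<partial>M)"
      unfolding V_def using xy
      by (intro Bochner_Integration.integral_add[symmetric] bdd_meas_integrable)
        (auto intro!: bdd_pos_walk_intros simp del: K.simps)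
    also have "\<dots> = (\<integral>z. ?w y z * ln (K (Suc l) y z / ?w y z * K (l + 2) x z) \<partial>M)"
    proof (intro Bochner_Integration.integral_cong refl)
      fix z assume z: "z \<in> space M"
      have "ln (K (Suc l) y z / ?w y z * K (l + 2) x z) = ?v y z + ?u x z"
        using xy z by (intro ln_mult_pos divide_pos_pos K_pos walk_kernel_pos)
      then show "?w y z * ?v y z + ?w y z * ?u x z = ?w y z * ln (K (Suc l) y z / ?w y z * K (l + 2) x z)"
        by (simp only: distrib_left)
    qed
    \<comment> \<open>Jensen over \<open>z\<close>: the two sides join there into a walk of length
      \<open>2 * l + 3\<close> from \<open>x\<close> to \<open>y\<close>.\<close>
    also have "\<dots> \<le> (\<integral>z. ?w y z \<partial>M) *
        ln ((\<integral>z. ?w y z * (K (Suc l) y z / ?w y z * K (l + 2) x z) \<partial>M) / (\<integral>z. ?w y z \<partial>M))"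
      using xy by (intro ln_integral_ge) (auto intro!: bdd_pos_walk_intros simp del: K.simps)
    also have "(\<integral>z. ?w y z * (K (Suc l) y z / ?w y z * K (l + 2) x z) \<partial>M)
        = (\<integral>z. K (l + 2) x z * K (Suc l) z y \<partial>M)"
      using xy by (intro Bochner_Integration.integral_cong refl)
        (simp add: less_imp_neq[OF walk_kernel_pos, symmetric] K_sym[of y] del: K.simps)
    also have "\<dots> = K ((l + 2) + Suc l) x y"
      using xy by (intro K_add[symmetric]) auto
    also have "(l + 2) + Suc l = ?c" by simp
    finally have "V y + (\<integral>z. ?w y z * ?u x z \<partial>M) \<le> ln (K ?c x y)"
      using xy by (simp add: integral_walk_kernel del: K.simps)
    then show "?g x y * V y + ?g x y * (\<integral>z. ?w y z * ?u x z \<partial>M) \<le> ?g x y * ln (K ?c x y)"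
      using edge_density_pos[OF xy, of b] unfolding distrib_left[symmetric]
      by (intro mult_left_mono) auto
  qed (auto intro!: bdd_meas_integrable bdd_meas_integral bdd_pos_walk_intros V simp del: K.simps)
  also have "\<dots> \<le> (\<integral>x. \<integral>y. ?g x y \<partial>M \<partial>M) *
      ln ((\<integral>x. \<integral>y. ?g x y * K ?c x y \<partial>M \<partial>M) / (\<integral>x. \<integral>y. ?g x y \<partial>M \<partial>M))"
    by (intro ln_integral2_ge) (auto intro!: bdd_pos_walk_intros simp del: K.simps)
  also have "(\<integral>x. \<integral>y. ?g x y \<partial>M \<partial>M) = tr (Suc b)"
    using integral_vertex_density[OF assms] by (simp add: vertex_density_def)
  \<comment> \<open>The common edge is deleted using \<open>A \<le> 1\<close>; the remaining arcs of
    lengths \<open>b\<close> and \<open>2 * l + 3\<close> close up to a single cycle.\<close>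
  also have "tr (Suc b) * ln ((\<integral>x. \<integral>y. ?g x y * K ?c x y \<partial>M \<partial>M) / tr (Suc b))
      \<le> tr (Suc b) * ln (tr (b + ?c) / tr (Suc b))"
  proof -
    have "0 < (\<integral>x. \<integral>y. ?g x y * K ?c x y \<partial>M \<partial>M)"
      by (intro pos_meas_integral_pos pos_meas_integral) (auto intro!: bdd_pos_walk_intros simp del: K.simps)
    moreover have "(\<integral>x. \<integral>y. ?g x y * K ?c x y \<partial>M \<partial>M) \<le> (\<integral>x. \<integral>y. K b y x * K ?c y x \<partial>M \<partial>M)"
    proof (intro integral_mono)
      fix x y assume xy: "x \<in> space M" "y \<in> space M"
      have "A x y * (K b y x * K ?c y x) \<le> 1 * (K b y x * K ?c y x)"
        using xy A_le_1 K_pos by (intro mult_right_mono) (auto simp: less_imp_le)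
      then show "?g x y * K ?c x y \<le> K b y x * K ?c y x"
        using xy K_sym[OF xy] by (simp add: edge_density_def mult_ac del: K.simps)
    qed (auto intro!: bdd_meas_integrable bdd_meas_integral bdd_pos_walk_intros simp del: K.simps)
    moreover have "(\<integral>x. \<integral>y. K b y x * K ?c y x \<partial>M \<partial>M) = tr (b + ?c)"
      using assms by (intro tr_add[symmetric]) auto
    ultimately show ?thesis
      using tr_pos by (intro mult_left_mono) (auto simp: less_imp_le divide_right_mono)
  qed
  finally show ?thesis .
qed

text \<open>Splitting \<open>ln (K (l + 2))\<close> into a log-ratio and the logarithm of the
  transition density produces a second \<open>walk_entropy\<close>. The two walks have
  \<open>(l + 1) + (l + 2)\<close> steps in total, each worth \<open>walk_entropy b 0\<close>, and
  their common ends cost one copy of \<open>vertex_entropy\<close>.\<close>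

lemma tr_glue_ge:
  assumes "1 \<le> b"
  shows "real (2 * l + 3) * (tr (Suc b) * ln (tr (Suc b)) - G (Suc b) 1 b)
     \<le> tr (Suc b) * ln (tr (b + (2 * l + 3)) / tr (Suc b))"
proof -
  let ?m = "vertex_density b"
  let ?w = "walk_kernel b (Suc l)"
  have "(\<integral>x. \<integral>z. ?m x * (?w x z * ln (K (l + 2) x z)) \<partial>M \<partial>M)
      = (\<integral>x. \<integral>z. ?m x * (?w x z * ln (K (l + 2) x z / ?w x z)) + ?m x * (?w x z * ln (?w x z)) \<partial>M \<partial>M)"
    by (intro Bochner_Integration.integral_cong refl)
      (simp add: ln_div less_imp_neq[OF K_pos, symmetric] less_imp_neq[OF walk_kernel_pos, symmetric]
         algebra_simps del: K.simps walk_kernel.simps)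
  also have "\<dots> = (\<integral>x. (\<integral>z. ?m x * (?w x z * ln (K (l + 2) x z / ?w x z)) \<partial>M)
      + (\<integral>z. ?m x * (?w x z * ln (?w x z)) \<partial>M) \<partial>M)"
    by (intro Bochner_Integration.integral_cong refl Bochner_Integration.integral_add
        bdd_meas_integrable)
      (auto intro!: bdd_pos_walk_intros simp del: K.simps walk_kernel.simps)
  also have "\<dots> = (\<integral>x. \<integral>z. ?m x * (?w x z * ln (K (l + 2) x z / ?w x z)) \<partial>M \<partial>M)
      + (\<integral>x. \<integral>z. ?m x * (?w x z * ln (?w x z)) \<partial>M \<partial>M)"
    by (intro Bochner_Integration.integral_add bdd_meas_integrable bdd_meas_integral)
      (auto intro!: bdd_pos_walk_intros simp del: K.simps walk_kernel.simps)
  also have "(\<integral>x. \<integral>z. ?m x * (?w x z * ln (K (l + 2) x z / ?w x z)) \<partial>M \<partial>M) = walk_entropy b (Suc l)"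
    by (simp add: walk_entropy_def del: K.simps walk_kernel.simps)
  finally have "walk_entropy b l + walk_entropy b (Suc l)
      + (tr (Suc b) * ln (tr (Suc b)) - vertex_entropy b)
      \<le> tr (Suc b) * ln (tr (b + (2 * l + 3)) / tr (Suc b))"
    using tr_glue_ge_entropy[OF assms, of l] walk_kernel_self_entropy_ge[OF assms, of "Suc l"]
    by linarith
  moreover have "real (2 * l + 3) * walk_entropy b 0 \<le> walk_entropy b l + walk_entropy b (Suc l)"
    using walk_entropy_ge[of l b] walk_entropy_ge[of "Suc l" b] by (simp add: algebra_simps)
  \<comment> \<open>Of the \<open>2 * l + 3\<close> copies of \<open>vertex_entropy\<close> supplied
    by \<open>walk_entropy_0\<close>, \<open>2 * l + 2\<close> remain and are bounded below by
    convexity.\<close>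
  moreover have "tr (Suc b) * ln (tr (Suc b)) \<le> vertex_entropy b"
    using integral_mult_ln_self_ge[OF pos_meas_vertex_density[OF measurable_ident], of b]
    unfolding vertex_entropy_def id_def integral_vertex_density[OF assms] .
  then have "real (2 * l + 2) * (tr (Suc b) * ln (tr (Suc b))) \<le> real (2 * l + 2) * vertex_entropy b"
    by (intro mult_left_mono) auto
  ultimately show ?thesis
    unfolding walk_entropy_0[OF assms] by (simp add: algebra_simps)
qed

section \<open>Combining the backtracking and gluing bounds\<close>

lemma tr_odd_ge:
  assumes "0 < k" "k < n" and e: "real n / real k + 1 \<le> real e"
  shows "tr (2 * k + 1) ^ e \<le> tr (2 * n + 1)"
proof -
  define N where "N = 2 * real (n - k)"
  define \<tau> t where "\<tau> = tr (2 * k + 1)" and "t = tr (2 * n + 1)"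
  define X Y m where "X = ln (t / \<tau>)" and "Y = ln \<tau>" and "m = G (2 * k + 1) 1 (2 * k) / \<tau>"
  have pos: "\<tau> > 0" "t > 0" "Y \<le> 0" unfolding \<tau>_def t_def Y_def using tr_pos tr_le_1 by auto
  have N: "N > 0" using assms unfolding N_def by simp
  \<comment> \<open>With this \<open>l\<close>, \<open>N = 2 * l + 2\<close>, and the glued even
    cycle has length \<open>N + 2\<close>.\<close>
  obtain l where l: "n = k + Suc l" using less_imp_Suc_add[OF assms(2)] by auto
  have glue: "(N + 1) * (Y - m) \<le> X"
  proof -
    have eq: "2 * k + (2 * l + 3) = 2 * n + 1" unfolding l by simp
    have "real (2 * l + 3) * (\<tau> * Y - \<tau> * m) \<le> \<tau> * X"
      using tr_glue_ge[of "2 * k" l, unfolded eq] assms(1) pos unfolding \<tau>_def t_def X_def Y_def m_def by simp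
    moreover have "real (2 * l + 3) = N + 1" unfolding N_def l by simp
    ultimately have "(N + 1) * (\<tau> * Y - \<tau> * m) \<le> \<tau> * X" by (simp only:)
    then have "\<tau> * ((N + 1) * (Y - m)) \<le> \<tau> * X" by (simp add: algebra_simps)
    then show ?thesis using pos by simp
  qed
  have backtrack: "N * m \<le> (2 * real k - 1) * X"
  proof -
    have eq: "2 * k + 1 + 2 * (n - k) = 2 * n + 1" using assms by simp
    have "2 * real (n - k) * (\<tau> * m) \<le> real (2 * k - 1) * (\<tau> * X)"
      using tr_backtrack_ge[of "2 * k + 1" "n - k", unfolded eq] assms pos
      unfolding \<tau>_def t_def X_def m_def by simp
    then have "\<tau> * (N * m) \<le> \<tau> * ((2 * real k - 1) * X)"
      using assms(1) unfolding N_def by (simp add: algebra_simps of_nat_diff)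
    then show ?thesis using pos by simp
  qed
  \<comment> \<open>Adding \<open>N\<close> times \<open>glue\<close> to \<open>N + 1\<close> times
    \<open>backtrack\<close> cancels \<open>m\<close>; the coefficient of \<open>X\<close> is
    \<open>N + (N + 1) * (2 * k - 1)\<close>.\<close>
  have main: "N * (N + 1) * Y \<le> (2 * k * (N + 1) - 1) * X"
    using mult_left_mono[OF glue, of N] mult_left_mono[OF backtrack, of "N + 1"] N
    by (simp add: algebra_simps)
  have D: "2 * k * (N + 1) - 1 > 0"
  proof -
    have "1 * 1 < (2 * real k) * (N + 1)" using N assms(1) by (intro mult_strict_mono) auto
    then show ?thesis by simp
  qed
  \<comment> \<open>As \<open>Y \<le> 0\<close>, it suffices to compare coefficients. With
    \<open>n / k = 1 + N / (2 * k)\<close> the slack is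
    \<open>2 * k * (N + 1) - 1 - N / (2 * k)\<close>, which is positive.\<close>
  have "N * (N + 1) \<le> (2 * k * (N + 1) - 1) * (real e - 1)"
  proof -
    have "N * (N + 1) \<le> (2 * k * (N + 1) - 1) * (1 + N / (2 * k))"
    proof -
      have "(2 * k * (N + 1) - 1) * (1 + N / (2 * k)) - N * (N + 1) = 2 * k * (N + 1) - 1 - N / (2 * k)"
        using assms(1) by (simp add: field_simps)
      moreover have "N / (2 * k) \<le> N" "N \<le> k * N" using N assms(1) by (auto simp: divide_le_eq)
      moreover have "1 \<le> real k" "0 < k * N" using N assms(1) by simp_all
      ultimately show ?thesis unfolding distrib_left mult_1_right mult.assoc by linarith
    qed
    also have "1 + N / (2 * k) = real n / k"
      unfolding N_def l using assms(1) by (simp add: field_simps)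
    also have "(2 * k * (N + 1) - 1) * (real n / k) \<le> (2 * k * (N + 1) - 1) * (real e - 1)"
      using D e by (intro mult_left_mono) auto
    finally show ?thesis .
  qed
  then have "(2 * k * (N + 1) - 1) * ((real e - 1) * Y) \<le> N * (N + 1) * Y"
    using pos(3) by (simp add: mult_right_mono_neg mult.assoc[symmetric])
  with main have "(2 * k * (N + 1) - 1) * ((real e - 1) * Y) \<le> (2 * k * (N + 1) - 1) * X"
    by linarith
  then have "(real e - 1) * Y \<le> X" using D by simp
  then have "real e * ln \<tau> \<le> ln t"
    using pos unfolding X_def Y_def by (simp add: ln_div algebra_simps)
  then have "ln (\<tau> ^ e) \<le> ln t" using pos by (simp add: ln_realpow)
  then show ?thesis using pos unfolding \<tau>_def t_def by simp
qed

subsection \<open>Cycle integrals\<close>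

text \<open>The closing factor \<open>F\<close> is arbitrary so that the induction can integrate out
  the last vertex and absorb the result into a new factor \<open>F'\<close>. The case
  \<open>m = 0\<close> is separate because \<open>K 0\<close> is not the identity.\<close>

lemma path_integral:
  assumes "bdd_meas (M \<Otimes>\<^sub>M M) (\<lambda>p. F (fst p) (snd p))"
  shows "(\<integral>x. (\<Prod>i<m. A (x i) (x (Suc i))) * F (x 0) (x m) \<partial>Pi\<^sub>M {..<Suc m} (\<lambda>_. M))
    = (if m = 0 then \<integral>x. F x x \<partial>M else \<integral>x. \<integral>y. K m x y * F x y \<partial>M \<partial>M)"
  using assms
proof (induction m arbitrary: F)
  case 0
  interpret product_sigma_finite "\<lambda>_::nat. M" ..
  have "(\<lambda>x. F x x) \<in> borel_measurable M"
    using measurable_compose[OF _ bdd_meas_measurable[OF 0], of "\<lambda>x. (x, x)" M] by simp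
  then show ?case
    using product_integral_singleton[of "\<lambda>x. F x x" 0] by (simp add: lessThan_Suc)
next
  case (Suc m)
  interpret product_sigma_finite "\<lambda>_::nat. M" ..
  let ?I = "{..<Suc m}"
  interpret Q: prob_space "Pi\<^sub>M (insert (Suc m) ?I) (\<lambda>_. M)" by (intro prob_space_PiM prob_space_axioms)
  let ?f = "\<lambda>x. (\<Prod>i<Suc m. A (x i) (x (Suc i))) * F (x 0) (x (Suc m))"
  define F' where "F' u v = (\<integral>y. A v y * F u y \<partial>M)" for u v
  note F = bdd_meas_compose2[OF Suc.prems]
  have F': "bdd_meas (M \<Otimes>\<^sub>M M) (\<lambda>p. F' (fst p) (snd p))"
    unfolding F'_def
    by (rule bdd_meas_integral) (auto intro!: bdd_pos_intros F)
  have "(\<integral>x. ?f x \<partial>Pi\<^sub>M {..<Suc (Suc m)} (\<lambda>_. M)) = (\<integral>x. ?f x \<partial>Pi\<^sub>M (insert (Suc m) ?I) (\<lambda>_. M))"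
    by (simp add: lessThan_Suc)
  also have "\<dots> = (\<integral>x. \<integral>y. ?f (x(Suc m := y)) \<partial>M \<partial>Pi\<^sub>M ?I (\<lambda>_. M))"
    by (intro product_integral_insert Q.bdd_meas_integrable)
      (auto intro!: bdd_pos_intros bdd_meas_prod F measurable_component_singleton)
  also have "\<dots> = (\<integral>x. (\<Prod>i<m. A (x i) (x (Suc i))) * F' (x 0) (x m) \<partial>Pi\<^sub>M ?I (\<lambda>_. M))"
  proof (intro Bochner_Integration.integral_cong refl)
    fix x
    have e: "?f (x(Suc m := y)) = (\<Prod>i<m. A (x i) (x (Suc i))) * (A (x m) y * F (x 0) y)" for y
    proof -
      have "(\<Prod>i<m. A ((x(Suc m := y)) i) ((x(Suc m := y)) (Suc i))) = (\<Prod>i<m. A (x i) (x (Suc i)))"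
        by (intro prod.cong) auto
      then show ?thesis by simp
    qed
    show "(\<integral>y. ?f (x(Suc m := y)) \<partial>M) = (\<Prod>i<m. A (x i) (x (Suc i))) * F' (x 0) (x m)"
      unfolding F'_def e by (rule Bochner_Integration.integral_mult_right_zero)
  qed
  also have "\<dots> = (if m = 0 then \<integral>x. F' x x \<partial>M else \<integral>x. \<integral>y. K m x y * F' x y \<partial>M \<partial>M)"
    by (rule Suc.IH[OF F'])
  also have "\<dots> = (\<integral>x. \<integral>y. K (Suc m) x y * F x y \<partial>M \<partial>M)"
  proof (cases "m = 0")
    case False
    have "(\<integral>x. \<integral>y. K m x y * F' x y \<partial>M \<partial>M) = (\<integral>x. \<integral>y. \<integral>z. K m x y * (A y z * F x z) \<partial>M \<partial>M \<partial>M)"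
      unfolding F'_def by simp
    also have "\<dots> = (\<integral>x. \<integral>z. \<integral>y. K m x y * (A y z * F x z) \<partial>M \<partial>M \<partial>M)"
      by (intro Bochner_Integration.integral_cong refl bdd_meas_swap) (auto intro!: bdd_pos_intros F)
    also have "\<dots> = (\<integral>x. \<integral>z. K (Suc m) x z * F x z \<partial>M \<partial>M)"
      using False K_add[of m 1]
      by (intro Bochner_Integration.integral_cong refl) (simp add: mult.assoc[symmetric])
    finally show ?thesis using False by simp
  qed (simp add: F'_def)
  finally show ?case by simp
qed

lemma cycle_integral:
  assumes "1 \<le> m"
  shows "(\<integral>x. (\<Prod>i<m. A (x i) (x (Suc i))) * A (x 0) (x m) \<partial>Pi\<^sub>M {..<Suc m} (\<lambda>_. M)) = tr (Suc m)"
proof -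
  have "(\<integral>x. (\<Prod>i<m. A (x i) (x (Suc i))) * A (x 0) (x m) \<partial>Pi\<^sub>M {..<Suc m} (\<lambda>_. M))
      = (\<integral>x. \<integral>y. K m x y * A x y \<partial>M \<partial>M)"
    using assms by (subst path_integral) (auto intro!: bdd_pos_intros)
  also have "\<dots> = (\<integral>x. \<integral>y. K m y x * K 1 y x \<partial>M \<partial>M)"
  proof (intro Bochner_Integration.integral_cong refl)
    fix x y assume xy: "x \<in> space M" "y \<in> space M"
    then show "K m x y * A x y = K m y x * K 1 y x"
      using K_sym[OF xy, of m] A_sym[OF xy] by simp
  qed
  also have "\<dots> = tr (Suc m)"
    using tr_add[OF assms order_refl] by simp
  finally show ?thesis .
qed

end

section \<open>Homomorphism densities of cycles\<close>

text \<open>With the smaller end first, the wrap-around edge becomes \<open>(0, m)\<close>; for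
  \<open>2 \<le> m\<close> it differs from every consecutive pair, so it contributes a factor of its
  own.\<close>

lemma edge_pairs_cycle_graph:
  assumes "2 \<le> m"
  shows "{(i, j). i < j \<and> {i, j} \<in> edges (cycle_graph (Suc m))}
    = insert (0, m) ((\<lambda>i. (i, Suc i)) ` {..<m})"
proof -
  have edges: "edges (cycle_graph (Suc m)) = (\<lambda>a. {a, Suc a}) ` {..<m} \<union> {{m, 0}}"
  proof -
    have "edges (cycle_graph (Suc m)) = (\<lambda>a. {a, (a + 1) mod Suc m}) ` {..<Suc m}"
      unfolding cycle_graph_def by auto
    also have "\<dots> = (\<lambda>a. {a, (a + 1) mod Suc m}) ` {..<m} \<union> {{m, 0}}"
      by (simp add: lessThan_Suc)
    also have "(\<lambda>a. {a, (a + 1) mod Suc m}) ` {..<m} = (\<lambda>a. {a, Suc a}) ` {..<m}"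
      by (rule image_cong) auto
    finally show ?thesis .
  qed
  show ?thesis
    unfolding edges using assms by (auto simp: doubleton_eq_iff)
qed

lemma hom_density_cycle_graph:
  assumes "2 \<le> m"
  shows "hom_density (cycle_graph (Suc m)) W =
    (\<integral>x. (\<Prod>i<m. W (x i, x (Suc i))) * W (x 0, x m) \<partial>Pi\<^sub>M {..<Suc m} (\<lambda>_. unit_interval_measure))"
proof -
  have "(0, m) \<notin> (\<lambda>i. (i, Suc i)) ` {..<m}" "inj_on (\<lambda>i. (i, Suc i)) {..<m}"
    using assms by (auto intro: inj_onI)
  then show ?thesis
    unfolding hom_density_def edge_pairs_cycle_graph[OF assms]
    by (simp add: prod.reindex cycle_graph_def mult.commute)
qed

section \<open>From positive kernels to arbitrary graphons\<close>

lemma space_unit_interval_measure: "space unit_interval_measure = {0..1}"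
  by (simp add: space_restrict_space)

lemma prob_space_unit_interval_measure: "prob_space unit_interval_measure"
  by (intro prob_spaceI) (simp add: space_restrict_space emeasure_restrict_space)

lemma graphon_bounds:
  assumes "graphon W" "x \<in> {0..1}" "y \<in> {0..1}"
  shows "0 \<le> W (x, y)" "W (x, y) \<le> 1"
  using assms unfolding graphon_def by auto

text \<open>Truncating from below at \<open>\<epsilon>\<close> yields a positive kernel, and
  \<open>\<epsilon> \<le> 1\<close> preserves the upper bound one, so \<open>tr_odd_ge\<close>
  applies.\<close>

lemma hom_density_positive_graphon_ge:
  assumes W: "graphon W" and \<epsilon>: "0 < \<epsilon>" "\<epsilon> \<le> 1"
    and nk: "0 < k" "k < n" "real n / real k + 1 \<le> real e"
  shows "hom_density (cycle_graph (2 * k + 1)) (\<lambda>p. max \<epsilon> (W p)) ^ e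
    \<le> hom_density (cycle_graph (2 * n + 1)) (\<lambda>p. max \<epsilon> (W p))"
proof -
  interpret prob_space unit_interval_measure by (rule prob_space_unit_interval_measure)
  interpret pos_kernel unit_interval_measure "\<lambda>x y. max \<epsilon> (W (x, y))"
  proof
    have "(\<lambda>p. max \<epsilon> (W (fst p, snd p))) \<in> borel_measurable (unit_interval_measure \<Otimes>\<^sub>M unit_interval_measure)"
      using W unfolding graphon_def by (auto intro!: borel_measurable_max)
    moreover have "\<forall>p\<in>space (unit_interval_measure \<Otimes>\<^sub>M unit_interval_measure).
        \<epsilon> \<le> max \<epsilon> (W (fst p, snd p)) \<and> max \<epsilon> (W (fst p, snd p)) \<le> 1"
      using \<epsilon> graphon_bounds[OF W] by (auto simp: space_pair_measure space_unit_interval_measure)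
    ultimately show "pos_meas (unit_interval_measure \<Otimes>\<^sub>M unit_interval_measure) (\<lambda>p. max \<epsilon> (W (fst p, snd p)))"
      using \<epsilon>(1) unfolding pos_meas_def by blast
  qed (use W \<epsilon> in \<open>auto simp: graphon_def space_unit_interval_measure\<close>)
  have "hom_density (cycle_graph (2 * l + 1)) (\<lambda>p. max \<epsilon> (W p)) = tr (2 * l + 1)" if "0 < l" for l
    using cycle_integral[of "2 * l"] hom_density_cycle_graph[of "2 * l"] that by simp
  then show ?thesis using tr_odd_ge[OF nk] nk by simp
qed

text \<open>The limit serves to remove the truncation: the integrands converge pointwise because
  \<open>W\<close> is nonnegative, and the constant one dominates them.\<close>

lemma
  assumes W: "graphon W" and m: "2 \<le> m"
  shows hom_density_cycle_graph_nonneg: "0 \<le> hom_density (cycle_graph (Suc m)) W"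
    and hom_density_cycle_graph_le_1: "hom_density (cycle_graph (Suc m)) W \<le> 1"
    and hom_density_cycle_graph_max_tendsto:
      "(\<lambda>j. hom_density (cycle_graph (Suc m)) (\<lambda>p. max (1 / real (Suc j)) (W p)))
         \<longlonglongrightarrow> hom_density (cycle_graph (Suc m)) W"
proof -
  let ?N = "Pi\<^sub>M {..<Suc m} (\<lambda>_. unit_interval_measure)"
  interpret prob_space unit_interval_measure by (rule prob_space_unit_interval_measure)
  interpret N: prob_space ?N by (intro prob_space_PiM prob_space_unit_interval_measure)
  define f where "f V x = (\<Prod>i<m. V (x i, x (Suc i))) * V (x 0, x m)"
    for V :: "real \<times> real \<Rightarrow> real" and x :: "nat \<Rightarrow> real"
  have meas: "f V \<in> borel_measurable ?N"
    if V: "V \<in> borel_measurable (unit_interval_measure \<Otimes>\<^sub>M unit_interval_measure)" for V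
  proof -
    have "(\<lambda>x. V (x a, x b)) \<in> borel_measurable ?N" if "a \<le> m" "b \<le> m" for a b
      using that
      by (intro measurable_compose[OF measurable_Pair V] measurable_component_singleton) auto
    then show ?thesis
      unfolding f_def by (intro borel_measurable_times borel_measurable_prod) auto
  qed
  have comp: "x i \<in> {0..1}" if "x \<in> space ?N" "i \<le> m" for x i
    using that by (auto simp: space_PiM space_unit_interval_measure PiE_iff)
  have bound: "0 \<le> f V x \<and> f V x \<le> 1"
    if x: "x \<in> space ?N"
      and V: "\<And>a b. a \<in> {0..1} \<Longrightarrow> b \<in> {0..1} \<Longrightarrow> 0 \<le> V (a, b) \<and> V (a, b) \<le> 1" for V x
  proof -
    have "0 \<le> V (x a, x b) \<and> V (x a, x b) \<le> 1" if "a \<le> m" "b \<le> m" for a b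
      using comp[OF x] that by (intro V) auto
    then show ?thesis
      unfolding f_def by (intro conjI mult_nonneg_nonneg prod_nonneg mult_le_one prod_le_1) auto
  qed
  have Wm: "W \<in> borel_measurable (unit_interval_measure \<Otimes>\<^sub>M unit_interval_measure)"
    using W by (simp add: graphon_def)
  have boundW: "0 \<le> f W x" "f W x \<le> 1" if "x \<in> space ?N" for x
    using bound[of x W] graphon_bounds[OF W] that by auto
  have eq: "hom_density (cycle_graph (Suc m)) V = (\<integral>x. f V x \<partial>?N)" for V
    unfolding f_def by (rule hom_density_cycle_graph[OF m])
  show "0 \<le> hom_density (cycle_graph (Suc m)) W"
    unfolding eq using boundW by (intro integral_nonneg_AE AE_I2) auto
  have "(\<integral>x. f W x \<partial>?N) \<le> (\<integral>x. 1 \<partial>?N)"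
  proof (rule integral_mono)
    show "integrable ?N (f W)"
      using meas[OF Wm] boundW by (intro N.integrable_const_bound[where B = 1] AE_I2) auto
  qed (use boundW in auto)
  then show "hom_density (cycle_graph (Suc m)) W \<le> 1"
    unfolding eq by (simp add: N.prob_space)
  show "(\<lambda>j. hom_density (cycle_graph (Suc m)) (\<lambda>p. max (1 / real (Suc j)) (W p)))
         \<longlonglongrightarrow> hom_density (cycle_graph (Suc m)) W"
    unfolding eq
  proof (rule integral_dominated_convergence[where w = "\<lambda>_. 1"])
    show "AE x in ?N. (\<lambda>j. f (\<lambda>p. max (1 / real (Suc j)) (W p)) x) \<longlonglongrightarrow> f W x"
    proof (rule AE_I2)
      fix x assume x: "x \<in> space ?N"
      have lim: "(\<lambda>j. max (1 / real (Suc j)) (W (x a, x b))) \<longlonglongrightarrow> W (x a, x b)" if "a \<le> m" "b \<le> m" for a b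
        using tendsto_max[OF LIMSEQ_inverse_real_of_nat tendsto_const, of "W (x a, x b)"]
          graphon_bounds(1)[OF W comp[OF x that(1)] comp[OF x that(2)]]
        by (simp add: inverse_eq_divide)
      show "(\<lambda>j. f (\<lambda>p. max (1 / real (Suc j)) (W p)) x) \<longlonglongrightarrow> f W x"
        unfolding f_def by (intro tendsto_mult tendsto_prod lim) auto
    qed
    show "AE x in ?N. norm (f (\<lambda>p. max (1 / real (Suc j)) (W p)) x) \<le> 1" for j
    proof (rule AE_I2)
      fix x assume x: "x \<in> space ?N"
      have "0 \<le> f (\<lambda>p. max (1 / real (Suc j)) (W p)) x \<and> f (\<lambda>p. max (1 / real (Suc j)) (W p)) x \<le> 1"
        by (rule bound[OF x]) (simp add: le_max_iff_disj graphon_bounds[OF W])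
      then show "norm (f (\<lambda>p. max (1 / real (Suc j)) (W p)) x) \<le> 1"
        by simp
    qed
    show "f (\<lambda>p. max (1 / real (Suc j)) (W p)) \<in> borel_measurable ?N" for j
      by (intro meas borel_measurable_max borel_measurable_const Wm)
    show "f W \<in> borel_measurable ?N"
      by (rule meas[OF Wm])
  qed simp
qed

text \<open>The weak inequality survives the limit; the natural-number exponent makes the power
  continuous even where the limiting density vanishes.\<close>

lemma hom_density_odd_cycle_ge:
  assumes W: "graphon W" and nk: "0 < k" "k < n" "real n / real k + 1 \<le> real e"
  shows "hom_density (cycle_graph (2 * k + 1)) W ^ e \<le> hom_density (cycle_graph (2 * n + 1)) W"
proof -
  have lim: "(\<lambda>j. hom_density (cycle_graph (2 * l + 1)) (\<lambda>p. max (1 / real (Suc j)) (W p)))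
         \<longlonglongrightarrow> hom_density (cycle_graph (2 * l + 1)) W" if "0 < l" for l
    using hom_density_cycle_graph_max_tendsto[OF W, of "2 * l"] that by simp
  show ?thesis
  proof (rule LIMSEQ_le[OF tendsto_power[OF lim] lim])
    show "\<exists>N. \<forall>j\<ge>N. hom_density (cycle_graph (2 * k + 1)) (\<lambda>p. max (1 / real (Suc j)) (W p)) ^ e
        \<le> hom_density (cycle_graph (2 * n + 1)) (\<lambda>p. max (1 / real (Suc j)) (W p))"
      by (intro exI[of _ 0] allI impI hom_density_positive_graphon_ge[OF W _ _ nk]) auto
  qed (use nk in auto)
qed

lemma density_quotient_odd_cycle_le:
  assumes W: "graphon W" and nk: "0 < k" "k < n" "real n / real k + 1 \<le> real e"
    and ne: "hom_density (cycle_graph (2 * k + 1)) W \<noteq> 0" "hom_density (cycle_graph (2 * k + 1)) W \<noteq> 1"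
  shows "e2ennreal (ext_ln (hom_density (cycle_graph (2 * n + 1)) W)
      / ext_ln (hom_density (cycle_graph (2 * k + 1)) W)) \<le> ennreal (real e)"
proof -
  define \<tau> t where "\<tau> = hom_density (cycle_graph (2 * k + 1)) W"
    and "t = hom_density (cycle_graph (2 * n + 1)) W"
  have \<tau>: "0 < \<tau>" "\<tau> < 1"
    using hom_density_cycle_graph_nonneg[OF W, of "2 * k"] hom_density_cycle_graph_le_1[OF W, of "2 * k"]
      nk ne unfolding \<tau>_def by auto
  have le: "\<tau> ^ e \<le> t" unfolding \<tau>_def t_def by (rule hom_density_odd_cycle_ge[OF W nk])
  moreover have "0 < \<tau> ^ e" using \<tau> by simp
  \<comment> \<open>This excludes the infinite value of the quotient.\<close>
  ultimately have t: "0 < t" by linarith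
  have "real e * ln \<tau> \<le> ln t"
    using le t \<tau> by (simp flip: ln_realpow)
  \<comment> \<open>Here \<open>ln \<tau>\<close> is negative, so the division reverses the
    inequality.\<close>
  then have "ln t / ln \<tau> \<le> real e"
    using \<tau> by (simp add: neg_divide_le_eq)
  moreover have "ext_ln t / ext_ln \<tau> = ereal (ln t / ln \<tau>)"
    using \<tau> t by (simp add: ext_ln_def)
  ultimately show ?thesis
    unfolding \<tau>_def t_def by (simp add: e2ennreal_ereal ennreal_leI)
qed

section \<open>The lower bound from two disjoint cliques\<close>

definition two_blocks :: "real \<times> real \<Rightarrow> real" where
  "two_blocks p = of_bool (fst p < 1/2 \<longleftrightarrow> snd p < 1/2)"

lemma graphon_two_blocks: "graphon two_blocks"
  unfolding graphon_def two_blocks_def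
proof (intro conjI)
  have [measurable]: "(\<lambda>x::real. x) \<in> borel_measurable unit_interval_measure"
    by (rule measurable_restrict_space1) simp
  show "(\<lambda>p. of_bool (fst p < 1/2 \<longleftrightarrow> snd p < (1/2::real)) :: real)
      \<in> borel_measurable (unit_interval_measure \<Otimes>\<^sub>M unit_interval_measure)"
    unfolding of_bool_def by measurable
qed auto

text \<open>All consecutive vertices agree only if they all lie on one side, and then the closing
  factor is one. The two products on the right exclude each other since the index set is
  nonempty.\<close>

lemma prod_of_bool_Suc_eq:
  "(\<Prod>i<m. of_bool (S i \<longleftrightarrow> S (Suc i)) :: real) * of_bool (S 0 \<longleftrightarrow> S m)
    = (\<Prod>i<Suc m. of_bool (S i)) + (\<Prod>i<Suc m. of_bool (\<not> S i))"
proof -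
  have "(\<Prod>i<m. of_bool (S i \<longleftrightarrow> S (Suc i)) :: real)
      = (\<Prod>i<Suc m. of_bool (S i)) + (\<Prod>i<Suc m. of_bool (\<not> S i))"
    by (induction m) auto
  moreover have "(\<Prod>i<Suc m. of_bool (T i) :: real) * of_bool c = (\<Prod>i<Suc m. of_bool (T i))"
    if "T 0 \<Longrightarrow> T m \<Longrightarrow> c" for T c
  proof (cases c)
    case False
    then have "\<exists>i\<in>{..<Suc m}. of_bool (T i) = (0::real)" using that by auto
    then have "(\<Prod>i<Suc m. of_bool (T i) :: real) = 0" by (intro prod_zero) auto
    then show ?thesis by simp
  qed simp
  from this[of S "S 0 \<longleftrightarrow> S m"] this[of "\<lambda>i. \<not> S i" "S 0 \<longleftrightarrow> S m"]
  have "(\<Prod>i<Suc m. of_bool (S i) :: real) * of_bool (S 0 \<longleftrightarrow> S m) = (\<Prod>i<Suc m. of_bool (S i))"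
    "(\<Prod>i<Suc m. of_bool (\<not> S i) :: real) * of_bool (S 0 \<longleftrightarrow> S m) = (\<Prod>i<Suc m. of_bool (\<not> S i))"
    by blast+
  ultimately show ?thesis by (simp only: distrib_right)
qed

text \<open>All \<open>m + 1\<close> vertices fall into a given block with probability
  \<open>(1/2) ^ (m + 1)\<close>, and there are two blocks.\<close>

lemma hom_density_two_blocks:
  assumes "2 \<le> m"
  shows "hom_density (cycle_graph (Suc m)) two_blocks = (1/2) ^ m"
proof -
  interpret U: prob_space unit_interval_measure by (rule prob_space_unit_interval_measure)
  interpret product_sigma_finite "\<lambda>_::nat. unit_interval_measure" ..
  let ?N = "Pi\<^sub>M {..<Suc m} (\<lambda>_. unit_interval_measure)"
  have id[measurable]: "(\<lambda>x::real. x) \<in> borel_measurable unit_interval_measure"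
    by (rule measurable_restrict_space1) simp
  have half: "(\<integral>x. of_bool (x < 1/2) \<partial>unit_interval_measure) = (1/2 :: real)"
    "(\<integral>x. of_bool (\<not> x < 1/2) \<partial>unit_interval_measure) = (1/2 :: real)"
  proof -
    have "(\<integral>x. of_bool (x < 1/2) \<partial>unit_interval_measure) = (\<integral>x. indicator {0..<1/2::real} x \<partial>lborel :: real)"
      by (subst integral_restrict_space, simp, intro Bochner_Integration.integral_cong)
        (auto simp: indicator_def)
    also have "\<dots> = 1/2" by simp
    finally show "(\<integral>x. of_bool (x < 1/2) \<partial>unit_interval_measure) = (1/2 :: real)" .
    have "(\<integral>x. of_bool (\<not> x < 1/2) \<partial>unit_interval_measure) = (\<integral>x. indicator {1/2..1::real} x \<partial>lborel :: real)"
      by (subst integral_restrict_space, simp, intro Bochner_Integration.integral_cong)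
        (auto simp: indicator_def)
    also have "\<dots> = 1/2" by simp
    finally show "(\<integral>x. of_bool (\<not> x < 1/2) \<partial>unit_interval_measure) = (1/2 :: real)" .
  qed
  have int: "integrable unit_interval_measure (\<lambda>x. of_bool (x < 1/2) :: real)"
    "integrable unit_interval_measure (\<lambda>x. of_bool (\<not> x < 1/2) :: real)"
    by (rule U.integrable_const_bound[where B = 1]; simp add: of_bool_def; measurable)+
  have power: "(\<integral>x. (\<Prod>i<Suc m. g (x i)) \<partial>?N) = (\<integral>y. g y \<partial>unit_interval_measure) ^ Suc m"
    if "integrable unit_interval_measure g" for g :: "real \<Rightarrow> real"
    using product_integral_prod[of "{..<Suc m}" "\<lambda>_. g"] that by simp
  have "hom_density (cycle_graph (Suc m)) two_blocks
      = (\<integral>x. (\<Prod>i<Suc m. of_bool (x i < 1/2)) + (\<Prod>i<Suc m. of_bool (\<not> x i < 1/2)) \<partial>?N)"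
    unfolding hom_density_cycle_graph[OF assms] two_blocks_def fst_conv snd_conv
    by (intro Bochner_Integration.integral_cong refl prod_of_bool_Suc_eq)
  also have "\<dots> = (\<integral>x. (\<Prod>i<Suc m. of_bool (x i < 1/2)) \<partial>?N) + (\<integral>x. (\<Prod>i<Suc m. of_bool (\<not> x i < 1/2)) \<partial>?N)"
    by (intro Bochner_Integration.integral_add product_integrable_prod int) auto
  also have "\<dots> = (1/2) ^ Suc m + (1/2) ^ Suc m"
    by (simp only: power[OF int(1)] power[OF int(2)] half)
  finally show ?thesis by simp
qed

theorem theorem4p7:
  fixes n k :: nat
  assumes "0 < k" and "k < n"
  shows "ennreal (real n / real k)
           \<le> density_domination_exponent (cycle_graph (2 * k + 1)) (cycle_graph (2 * n + 1))
       \<and> density_domination_exponent (cycle_graph (2 * k + 1)) (cycle_graph (2 * n + 1))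
           \<le> ennreal (real_of_int \<lceil>real n / real k\<rceil> + 1)"
proof
  have d: "hom_density (cycle_graph (2 * l + 1)) two_blocks = (1/2) ^ (2 * l)" if "0 < l" for l
    using hom_density_two_blocks[of "2 * l"] that by simp
  \<comment> \<open>The factor \<open>ln (1/2)\<close> cancels, leaving the ratio of the
    exponents.\<close>
  have "ext_ln ((1/2) ^ (2 * n)) / ext_ln ((1/2) ^ (2 * k)) = ereal (real n / real k)"
    using assms by (simp add: ext_ln_def ln_realpow ln_div)
  then have eq: "ennreal (real n / real k)
      = e2ennreal (ext_ln (hom_density (cycle_graph (2 * n + 1)) two_blocks)
          / ext_ln (hom_density (cycle_graph (2 * k + 1)) two_blocks))"
    using assms d by (simp add: e2ennreal_ereal)
  have "hom_density (cycle_graph (2 * k + 1)) two_blocks \<noteq> 0"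
    "hom_density (cycle_graph (2 * k + 1)) two_blocks \<noteq> 1"
    using assms d[of k] power_Suc_less_one[of "1/2::real" "2 * k - 1"] by auto
  then show "ennreal (real n / real k)
      \<le> density_domination_exponent (cycle_graph (2 * k + 1)) (cycle_graph (2 * n + 1))"
    unfolding density_domination_exponent_def eq
    by (intro SUP_upper) (simp add: graphon_two_blocks)
next
  \<comment> \<open>Rounding \<open>n / k\<close> up makes the exponent a natural number, and the
    added one supplies the slack required by the power inequality.\<close>
  define e where "e = nat (\<lceil>real n / real k\<rceil> + 1)"
  have "0 \<le> \<lceil>real n / real k\<rceil>" by (simp add: order_trans[of _ 0] less_le_trans[of _ 0])
  then have e: "real e = real_of_int \<lceil>real n / real k\<rceil> + 1" unfolding e_def by simp
  then have "real n / real k + 1 \<le> real e" by simp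
  then show "density_domination_exponent (cycle_graph (2 * k + 1)) (cycle_graph (2 * n + 1))
      \<le> ennreal (real_of_int \<lceil>real n / real k\<rceil> + 1)"
    unfolding density_domination_exponent_def e[symmetric]
    by (intro SUP_least density_quotient_odd_cycle_le[OF _ assms]) simp_all
qed

end
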